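(* Let $n$ be a positive integer coprime with $6$. Then, for indeterminates $a$ and $q$, modulo $[n](1-aq^n)(a-q^n)$, $$ \sum_{k=0}^{n-1}\frac{(aq;q^2)_k (q/a;q^2)_k (q;q^2)_{2k}}{(q^2;q^2)_{2k}(aq^6;q^6)_k (q^6/a;q^6)_k }[8k+1]q^{2k^2} \equiv q^{-(n-1)/2}[n]\biggl(\frac{-3}{n}\biggr). $$
   Context: $(x;q)_k=\prod_{j=0}^{k-1}(1-xq^j)$ for integers $k\ge0$; $[n]=[n]_q=(1-q^n)/(1-q)$; $\bigl(\frac{-3}{n}\bigr)$ is the Jacobi--Kronecker symbol. Congruence convention: for polynomials $A_1,A_2,P$, $A_1/A_2\equiv0\pmod{P}$ means $P$ divides $A_1$ and $P$ is coprime with $A_2$; for rational functions $A,B$, $A\equiv B\pmod P$ means $A-B\equiv0\pmod P$. *)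

theory Defs
  imports
    "HOL-Computational_Algebra.Computational_Algebra"
    "HOL-Number_Theory.Number_Theory"
begin

definition qpoch :: "'a::comm_ring_1 \<Rightarrow> 'a \<Rightarrow> nat \<Rightarrow> 'a" where
  "qpoch x q k = (\<Prod>j<k. 1 - x * q ^ j)"

definition qint :: "'a::field \<Rightarrow> nat \<Rightarrow> 'a" where
  "qint q n = (1 - q ^ n) / (1 - q)"

(* Congruence of fractions modulo a polynomial. All three arguments live in the
   fraction field; the modulus must come from an element P of the ring 'a (in
   the application, a polynomial ring), and divisibility and coprimality are
   those of that ring. A2 ranges over all denominators of A - B, so cancelling
   common factors is allowed. *)
definition fract_cong :: "'a::{idom_divide, algebraic_semidom} fract \<Rightarrow> 'a fract \<Rightarrow> 'a fract \<Rightarrow> bool" where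
  "fract_cong A B M \<longleftrightarrow>
     (\<exists>A1 A2 P. A2 \<noteq> 0 \<and> A - B = Fraction_Field.Fract A1 A2 \<and>
        M = Fraction_Field.Fract P 1 \<and> P dvd A1 \<and> coprime P A2)"

(* The library's Legendre symbol has value 1 at p = 2 for every odd a, hence the
   separate clause prescribed by Kronecker's extension. *)
definition kronecker_prime :: "int \<Rightarrow> nat \<Rightarrow> int" where
  "kronecker_prime a p =
     (if p = 2 then
        (if even a then 0 else if a mod 8 = 1 \<or> a mod 8 = 7 then 1 else -1)
      else Legendre a (int p))"

(* The Kronecker symbol (a/n) for positive n. *)
definition kronecker :: "int \<Rightarrow> nat \<Rightarrow> int" where
  "kronecker a n = (\<Prod>p\<in>prime_factors n. kronecker_prime a p ^ multiplicity p n)"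

end

theory Submission
  imports Defs
begin

text \<open>
  Put \<open>p = q\<^sup>2\<close>. The sum is the case \<open>b = q\<close> of the cubic sum of Gasper and Rahman with summand
  \<open>(A, p/A; p)\<^sub>k (b; p)\<^sub>2\<^sub>k (1 - b p\<^sup>4\<^sup>k) p\<^bsup>k^2\<^esup> / ((p; p)\<^sub>2\<^sub>k (b p\<^sup>3/A, A b p\<^sup>2; p\<^sup>3)\<^sub>k)\<close>
  at \<open>A = a q\<close>. Two contiguous relations, each a WZ-type telescoping with a small certificate, give everything.

  The shift \<open>A \<mapsto> A p\<^sup>3\<close> changes \<open>n\<close> by 6 when \<open>a = q\<^bsup>-n\<^esup>\<close>; it evaluates the sum there, hence also at
  \<open>a = q\<^sup>n\<close>, and proves the congruence modulo \<open>(1 - a q\<^sup>n)(a - q\<^sup>n)\<close>.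

  The shift \<open>b \<mapsto> b p\<^sup>3\<close> shows that the sum vanishes for \<open>b = p\<^bsup>-M\<^esup>\<close> unless \<open>M\<close> is 1 modulo 3, also when
  \<open>k\<close> runs over half-integers. If \<open>q\<close> is a root of unity of order \<open>d\<close> dividing \<open>n\<close>, then
  \<open>q = p\<^bsup>-M\<^esup>\<close> with \<open>d = 2 M + 1\<close>. The range \<open>k < n\<close> splits into blocks
  \<open>s d \<le> 2 k < (s + 1) d\<close>, and each block is proportional to such a vanishing sum (over half-integers
  if \<open>s\<close> is odd). So the sum is 0 modulo every cyclotomic factor of \<open>[n]\<close>.
\<close>

section \<open>The Kronecker symbol of -3\<close>

text \<open>The nontrivial Dirichlet character modulo 3. Its periodicity suits an induction on n in
  steps of 6.\<close>

definition sgn3 :: "nat \<Rightarrow> int" where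
  "sgn3 n = (if n mod 3 = 0 then 0 else if n mod 3 = 1 then 1 else -1)"

lemma mod_3_cases:
  obtains "(m::nat) mod 3 = 0" | "m mod 3 = 1" | "m mod 3 = 2"
  by linarith

lemma sgn3_mult: "sgn3 (m * n) = sgn3 m * sgn3 n"
proof -
  have "(m * n) mod 3 = ((m mod 3) * (n mod 3)) mod 3" by (rule mod_mult_eq[symmetric])
  then show ?thesis
    by (cases m rule: mod_3_cases; cases n rule: mod_3_cases) (simp_all add: sgn3_def)
qed

lemma sgn3_1 [simp]: "sgn3 1 = 1" by (simp add: sgn3_def)

lemma sgn3_power: "sgn3 (m ^ k) = sgn3 m ^ k"
  by (induction k) (use sgn3_1 in \<open>simp_all add: sgn3_mult del: One_nat_def\<close>)

lemma sgn3_prod: "finite A \<Longrightarrow> sgn3 (\<Prod>x\<in>A. f x) = (\<Prod>x\<in>A. sgn3 (f x))"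
  by (induction A rule: finite_induct) (use sgn3_1 in \<open>simp_all add: sgn3_mult del: One_nat_def\<close>)

lemma Legendre_mod_3: "Legendre (int p) 3 = sgn3 p"
proof -
  have ex: "QuadRes 3 (int p) \<longleftrightarrow> p mod 3 = 0 \<or> p mod 3 = 1"
  proof
    assume "QuadRes 3 (int p)"
    then obtain y where y: "[y^2 = int p] (mod 3)" unfolding QuadRes_def by blast
    have "y^2 mod 3 = 0 \<or> y^2 mod 3 = 1"
    proof -
      have "y mod 3 = 0 \<or> y mod 3 = 1 \<or> y mod 3 = 2" by linarith
      moreover have "y^2 mod 3 = (y mod 3)^2 mod 3" by (simp add: power_mod)
      ultimately show ?thesis by (elim disjE) simp_all
    qed
    then have "int p mod 3 = 0 \<or> int p mod 3 = 1" using y by (simp add: cong_def)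
    then show "p mod 3 = 0 \<or> p mod 3 = 1" by presburger
  next
    assume "p mod 3 = 0 \<or> p mod 3 = 1"
    then have "int p mod 3 = 0 \<or> int p mod 3 = 1" by presburger
    then have "[0^2 = int p] (mod 3) \<or> [1^2 = int p] (mod 3)" by (auto simp: cong_def)
    then show "QuadRes 3 (int p)" unfolding QuadRes_def by blast
  qed
  have z: "[int p = 0] (mod 3) \<longleftrightarrow> p mod 3 = 0" unfolding cong_def by simp presburger
  show ?thesis unfolding Legendre_def ex z sgn3_def by simp
qed

text \<open>Reciprocity gives the symbol of 3 as \<open>sgn3 p\<close> times \<open>(-1)^h\<close>,
  because (3 - 1) / 2 = 1. Euler's criterion contributes the same sign for -1, and the two signs
  cancel.\<close>

lemma Legendre_minus_3:
  assumes "prime p" "p > 3"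
  shows "Legendre (-3) (int p) = sgn3 p"
proof -
  define h where "h = (p - 1) div 2"
  have p3: "\<not> 3 dvd p" using assms by (metis less_irrefl prime_nat_iff numeral_eq_one_iff semiring_norm(84) zero_neq_numeral)
  have s: "sgn3 p * sgn3 p = 1" using p3 by (auto simp: sgn3_def dvd_eq_mod_eq_0)
  have e: "(-1)^h * (-1)^h = (1::int)" by (simp flip: power_mult_distrib)
  have "Legendre (int p) (int 3) * Legendre (int 3) (int p) = (-1)^(h * ((3 - 1) div 2))"
    unfolding h_def by (rule Quadratic_Reciprocity) (use assms in auto)
  then have "sgn3 p * Legendre 3 (int p) = (-1)^h" by (simp add: Legendre_mod_3)
  then have L3: "Legendre 3 (int p) = sgn3 p * (-1)^h" using s by (metis mult.assoc mult_1)
  have "[Legendre (-3) (int p) = (-3)^h] (mod (int p))"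
    unfolding h_def using euler_criterion assms by simp
  also have "(-3::int)^h = (-1)^h * 3^h" by (simp flip: power_mult_distrib)
  also have "[(-1)^h * 3^h = (-1)^h * Legendre 3 (int p)] (mod (int p))"
    unfolding h_def using euler_criterion[of p 3] assms by (intro cong_mult cong_refl) (simp add: cong_sym)
  also have "(-1)^h * Legendre 3 (int p) = sgn3 p" unfolding L3 using e by (simp add: mult.left_commute)
  finally have c: "[Legendre (-3) (int p) = sgn3 p] (mod (int p))" .
  \<comment> \<open>Both values lie in {-1, 0, 1}, so they differ by at most 2 < p and the
    congruence is an equality.\<close>
  have "\<bar>Legendre (-3) (int p) - sgn3 p\<bar> < int p"
    using assms by (auto simp: Legendre_def sgn3_def)
  moreover have "int p dvd Legendre (-3) (int p) - sgn3 p" using c by (simp add: cong_iff_dvd_diff)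
  ultimately show ?thesis by (metis dvd_imp_le_int abs_of_nat eq_iff_diff_eq_0 linorder_not_le)
qed

lemma kronecker_minus_3:
  assumes "n > 0" "odd n" "\<not> 3 dvd n"
  shows "kronecker (-3) n = sgn3 n"
proof -
  have "kronecker_prime (-3) p ^ multiplicity p n = sgn3 (p ^ multiplicity p n)" if "p \<in> prime_factors n" for p
  proof -
    have p: "prime p" "p dvd n" using that by auto
    then have "p \<noteq> 2" "p \<noteq> 3" using assms by auto
    moreover have "p \<ge> 2" using p prime_ge_2_nat by blast
    ultimately have "p > 3" by linarith
    then show ?thesis using Legendre_minus_3[OF p(1)] \<open>p \<noteq> 2\<close> by (simp add: kronecker_prime_def sgn3_power)
  qed
  then have "kronecker (-3) n = (\<Prod>p\<in>prime_factors n. sgn3 (p ^ multiplicity p n))"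
    unfolding kronecker_def by (intro prod.cong) auto
  also have "\<dots> = sgn3 (\<Prod>p\<in>prime_factors n. p ^ multiplicity p n)" by (simp add: sgn3_prod)
  also have "(\<Prod>p\<in>prime_factors n. p ^ multiplicity p n) = n" using assms prod_prime_factors[of n] by simp
  finally show ?thesis .
qed

section \<open>The shift in a and the terminating sum\<close>

text \<open>The quotient of consecutive terms of the cubic sum at \<open>x = p^k\<close>, without
  the very-well-poised factor \<open>1 - b * p^(4*k)\<close>. The variable x in place of k turns the
  certificates into polynomial identities.\<close>

definition cubic_ratio :: "'a::field \<Rightarrow> 'a \<Rightarrow> 'a \<Rightarrow> 'a \<Rightarrow> 'a" where
  "cubic_ratio p a b x = (1 - a * x) * (1 - p * x / a) * (1 - b * x^2) * (1 - b * p * x^2) * (p * x^2) /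
     ((1 - b * p^3 * x^3 / a) * (1 - a * b * p^2 * x^3) * (1 - p * x^2) * (1 - p^2 * x^2))"

definition cubic_coeff :: "'a::field \<Rightarrow> 'a \<Rightarrow> 'a \<Rightarrow> nat \<Rightarrow> 'a" where
  "cubic_coeff p a b k = (\<Prod>j<k. cubic_ratio p a b (p ^ j))"

lemma cubic_coeff_0 [simp]: "cubic_coeff p a b 0 = 1" by (simp add: cubic_coeff_def)
lemma cubic_coeff_Suc: "cubic_coeff p a b (Suc k) = cubic_coeff p a b k * cubic_ratio p a b (p ^ k)" by (simp add: cubic_coeff_def)

text \<open>The WZ certificate behind \<open>shift_a_telescope\<close>, with denominators cleared
  and \<open>x = p^k\<close>: the left side combines the summands for the two parameters, the right
  side is the difference of the certificate at k + 1 and k.\<close>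

lemma shift_a_identity:
  fixes x p v b :: "'a::comm_ring_1"
  shows "(1 - b*x^4) * (p*(1 - x*v*p^2)*(1 - x*v*p)*(1 - x*v)*(v - b*x^3) - (v*p^2 - x)*(v*p - x)*(v - x)*(1 - b*v*p^2*x^3))
   = (v^2*p^2 - 1) * ((v*p^2 - x)*(1 - b*x^2)*(1 - b*p*x^2)*x^2*(1 - x*v) - (1 - x^2)*(p - x^2)*(1 - b*v*p^2*x^3)*(v - b*x^3))"
  by (simp add: algebra_simps power_numeral_reduce)

text \<open>The parameter \<open>1 / (v*p^2)\<close> here and \<open>p / v\<close> in
  \<open>cubic_ratio_high\<close> differ by the factor \<open>p^3\<close>. Writing both through v
  clears their inverses from the factors.\<close>

lemma cubic_ratio_low:
  fixes p v b x :: "'a::field"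
  assumes "v \<noteq> 0" "p \<noteq> 0"
  shows "cubic_ratio p (1 / (v*p^2)) b x = (v*p^2 - x) * (1 - x*v*p^3) * (1 - b*x^2) * (1 - b*p*x^2) * x^2 /
     (p * (1 - b*v*p^5*x^3) * (v - b*x^3) * (1 - p*x^2) * (1 - p^2*x^2))"
proof -
  have 1: "1 - 1 / (v*p^2) * x = (v*p^2 - x) / (v*p^2)" using assms by (simp add: field_simps)
  have 2: "1 - p * x / (1 / (v*p^2)) = 1 - x*v*p^3" using assms by (simp add: field_simps power_numeral_reduce)
  have 3: "1 - b * p^3 * x^3 / (1 / (v*p^2)) = 1 - b*v*p^5*x^3" using assms by (simp add: field_simps power_numeral_reduce)
  have 4: "1 - 1 / (v*p^2) * b * p^2 * x^3 = (v - b*x^3) / v" using assms by (simp add: field_simps power_numeral_reduce)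
  have 5: "A / (v*p^2) * B * C * D * (p*E) / (F * (G / v) * H * I) = A * B * C * D * E / (p * F * G * H * I)" for A B C D E F G H I
    using assms by (simp add: divide_simps power2_eq_square)
  show ?thesis unfolding cubic_ratio_def 1 2 3 4 5 ..
qed

lemma cubic_ratio_high:
  fixes p v b x :: "'a::field"
  assumes "v \<noteq> 0" "p \<noteq> 0"
  shows "cubic_ratio p (p / v) b x = (v - p*x) * (1 - x*v) * (1 - b*x^2) * (1 - b*p*x^2) * (p * x^2) /
     ((1 - b*v*p^2*x^3) * (v - b*p^3*x^3) * (1 - p*x^2) * (1 - p^2*x^2))"
proof -
  have 1: "1 - p / v * x = (v - p*x) / v" using assms by (simp add: field_simps)
  have 2: "1 - p * x / (p / v) = 1 - x*v" using assms by (simp add: field_simps power_numeral_reduce)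
  have 3: "1 - b * p^3 * x^3 / (p / v) = 1 - b*v*p^2*x^3" using assms by (simp add: field_simps power_numeral_reduce)
  have 4: "1 - p / v * b * p^2 * x^3 = (v - b*p^3*x^3) / v" using assms by (simp add: field_simps power_numeral_reduce)
  have 5: "A / v * B * C * D * E / (F * (G / v) * H * I) = A * B * C * D * E / (F * G * H * I)" for A B C D E F G H I
    using assms by (simp add: divide_simps)
  show ?thesis unfolding cubic_ratio_def 1 2 3 4 5 ..
qed

text \<open>Multiplying the parameter by \<open>p^3\<close> moves each base p product by three
  factors and each base \<open>p^3\<close> product by one, so the quotient of the two k-th terms is
  a rational function of \<open>p^k\<close>.\<close>

lemma cubic_coeff_ratio:
  fixes p v b :: "'a::field"
  assumes nz: "v \<noteq> 0" "p \<noteq> 0" and v1: "\<And>k. p^k*v \<noteq> 1" and vb: "\<And>k. v \<noteq> b*p^(3*k)" and bv: "\<And>k. b*v*p^(3*k+2) \<noteq> 1"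
    and x: "x = p^k"
  shows "cubic_coeff p (p / v) b k * ((1 - x*v*p^2)*(1 - x*v*p)*(1 - x*v)*(v - b*x^3)*(1 - b*v*p^2))
    = - cubic_coeff p (1 / (v*p^2)) b k * ((v*p^2 - x)*(v*p - x)*(v - x)*(1 - b*v*p^2*x^3)*(v - b))"
  unfolding x
proof (induction k)
  case 0
  show ?case by (simp add: algebra_simps)
next
  case (Suc k)
  define x where "x = p^k"
  define g h where "g = cubic_coeff p (1 / (v*p^2)) b k" and "h = cubic_coeff p (p / v) b k"
  define N where "N = (1 - b*x^2) * (1 - b*p*x^2) * x^2 / ((1 - p*x^2) * (1 - p^2*x^2))"
  have X: "p^Suc k = p * x" "(p*x)^3 = p^3*x^3" by (simp_all add: x_def power_mult_distrib)
  have nzs: "1 - x*v \<noteq> 0" "1 - x*v*p \<noteq> 0" "1 - x*v*p^2 \<noteq> 0" "v - b*x^3 \<noteq> 0" "v - b*p^3*x^3 \<noteq> 0"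
     "1 - b*v*p^2*x^3 \<noteq> 0" "1 - b*v*p^5*x^3 \<noteq> 0"
    using v1[of k] v1[of "Suc k"] v1[of "k+2"] vb[of k] vb[of "Suc k"] bv[of k] bv[of "Suc k"]
    by (auto simp: x_def power_add power_mult power_mult_distrib algebra_simps power_numeral_reduce)
  have L: "cubic_ratio p (1 / (v*p^2)) b x = (v*p^2 - x) * (1 - x*v*p^3) * N / (p * (1 - b*v*p^5*x^3) * (v - b*x^3))"
    unfolding cubic_ratio_low[OF nz] N_def by (simp add: mult_ac)
  have H: "cubic_ratio p (p / v) b x = (v - p*x) * (1 - x*v) * p * N / ((1 - b*v*p^2*x^3) * (v - b*p^3*x^3))"
    unfolding cubic_ratio_high[OF nz] N_def by (simp add: mult_ac)
  have IH: "h * ((1 - x*v*p^2)*(1 - x*v*p)*(1 - x*v)*(v - b*x^3)*(1 - b*v*p^2))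
     = - g * ((v*p^2 - x)*(v*p - x)*(v - x)*(1 - b*v*p^2*x^3)*(v - b))"
    using Suc by (simp add: g_def h_def x_def)
  have A: "1 - p*x*v*p^2 = 1 - x*v*p^3" "1 - p*x*v*p = 1 - x*v*p^2" "1 - p*x*v = 1 - x*v*p"
    "v*p^2 - p*x = p*(v*p - x)" "v*p - p*x = p*(v - x)" "1 - b*v*p^2*(p^3*x^3) = 1 - b*v*p^5*x^3"
    "v - b*(p^3*x^3) = v - b*p^3*x^3"
    by (simp_all add: algebra_simps power_numeral_reduce)
  \<comment> \<open>With most factors generalized to variables, only a cancellation of monomials is
    left.\<close>
  have gen: "h * ((v - p*x) * a0 * p * N / (d0 * e1)) * (a3 * a2 * a1 * e1 * K)
       = - (g * (w2 * a3 * N / (p * d1 * e0))) * (p*w1 * (p*w0) * (v - p*x) * d1 * (v - b))"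
    if "h * (a2 * a1 * a0 * e0 * K) = - g * (w2 * w1 * w0 * d0 * (v - b))" "d0 \<noteq> 0" "d1 \<noteq> 0" "e0 \<noteq> 0" "e1 \<noteq> 0"
    for a0 a1 a2 a3 d0 d1 e0 e1 K w0 w1 w2
  proof -
    have "h * ((v - p*x) * a0 * p * N / (d0 * e1)) * (a3 * a2 * a1 * e1 * K) = (h * (a2 * a1 * a0 * e0 * K)) * ((v - p*x) * p * N * a3 / (d0 * e0))"
      using that(2-) by (simp add: field_simps)
    also have "\<dots> = - (g * (w2 * a3 * N / (p * d1 * e0))) * (p*w1 * (p*w0) * (v - p*x) * d1 * (v - b))"
      unfolding that(1) using that(2-) nz by (simp add: field_simps)
    finally show ?thesis .
  qed
  show ?case
    unfolding cubic_coeff_Suc x_def[symmetric] g_def[symmetric] h_def[symmetric] X A L H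
    by (rule gen[OF IH]) (use nzs in auto)
qed

text \<open>The right side is 0 at K = 0 because of \<open>1 - p^(2*K)\<close>, and by
  \<open>shift_a_identity\<close> its increments are the summands on the left. It is a multiple of
  \<open>F K\<close>, so for a terminating sum a two-term relation remains.\<close>

lemma shift_a_telescope:
  fixes p v b :: "'a::field"
  assumes nz: "v \<noteq> 0" "p \<noteq> 0" and v1: "\<And>k. p^k*v \<noteq> 1" and vb: "\<And>k. v \<noteq> b*p^(3*k)"
    and bv: "\<And>k. b*v*p^(3*k+2) \<noteq> 1" and p1: "\<And>k. p^Suc k \<noteq> 1"
  defines "F \<equiv> cubic_coeff p (1 / (v*p^2)) b" and "H \<equiv> cubic_coeff p (p / v) b"
  shows "p*(v - b) * (\<Sum>k<K. (1 - b*p^(4*k)) * F k) + (1 - b*v*p^2) * (\<Sum>k<K. (1 - b*p^(4*k)) * H k)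
     = (v - b) * (v^2*p^2 - 1) * (1 - p^(2*K)) * (p - p^(2*K)) * (1 - b*v*p^(3*K+2)) * F K
         / ((1 - p^(K+2)*v) * (1 - p^(K+1)*v) * (1 - p^K*v))"
proof (induction K)
  case 0
  show ?case by simp
next
  case (Suc K)
  define x where "x = p^K"
  have nzs: "1 - x*v \<noteq> 0" "1 - x*v*p \<noteq> 0" "1 - x*v*p^2 \<noteq> 0" "1 - x*v*p^3 \<noteq> 0" "v - b*x^3 \<noteq> 0" "v - b \<noteq> 0"
     "1 - b*v*p^5*x^3 \<noteq> 0" "1 - p*x^2 \<noteq> 0" "1 - p^2*x^2 \<noteq> 0" "1 - b*v*p^2 \<noteq> 0"
    using v1[of K] v1[of "Suc K"] v1[of "K+2"] v1[of "K+3"] vb[of K] vb[of 0] bv[of 0] bv[of "Suc K"] p1[of "2*K"] p1[of "Suc (2*K)"]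
    by (auto simp: x_def power_add power_mult power_mult_distrib algebra_simps power_numeral_reduce)
  have P: "p^(4*K) = x^4" "p^(2*K) = x^2" "p^(K+2) * v = x*v*p^2" "p^(K+1) * v = x*v*p" "p^K*v = x*v" "b*v*p^(3*K+2) = b*v*p^2*x^3"
      "p^(2*Suc K) = p^2*x^2" "p^(Suc K+2) * v = x*v*p^3" "p^(Suc K+1) * v = x*v*p^2" "p^Suc K*v = x*v*p" "b*v*p^(3*Suc K+2) = b*v*p^5*x^3"
    by (simp_all add: x_def power_add power_mult power_mult_distrib algebra_simps power_numeral_reduce)
  have Hk: "(1 - b*v*p^2) * H K = - F K * ((v*p^2 - x)*(v*p - x)*(v - x)*(1 - b*v*p^2*x^3)*(v - b))
      / ((1 - x*v*p^2)*(1 - x*v*p)*(1 - x*v)*(v - b*x^3))"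
  proof (rule nonzero_eq_divide_eq[THEN iffD2])
    show "(1 - x*v*p^2)*(1 - x*v*p)*(1 - x*v)*(v - b*x^3) \<noteq> 0" using nzs by simp
    show "(1 - b*v*p^2) * H K * ((1 - x*v*p^2)*(1 - x*v*p)*(1 - x*v)*(v - b*x^3))
        = - F K * ((v*p^2 - x)*(v*p - x)*(v - x)*(1 - b*v*p^2*x^3)*(v - b))"
      using cubic_coeff_ratio[OF nz v1 vb bv x_def, folded F_def H_def] by (simp only: mult_ac)
  qed
  have F': "F (Suc K) = F K * ((v*p^2 - x) * (1 - x*v*p^3) * (1 - b*x^2) * (1 - b*p*x^2) * x^2 /
     (p * (1 - b*v*p^5*x^3) * (v - b*x^3) * (1 - p*x^2) * (1 - p^2*x^2)))"
    by (simp only: F_def cubic_coeff_Suc x_def[symmetric] cubic_ratio_low[OF nz])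
  define a0 a1 a2 a3 d0 d1 e0 f1 f2 u
    where "a0 = 1 - x*v" and "a1 = 1 - x*v*p" and "a2 = 1 - x*v*p^2" and "a3 = 1 - x*v*p^3" and "d0 = 1 - b*v*p^2*x^3"
      and "d1 = 1 - b*v*p^5*x^3" and "e0 = v - b*x^3" and "f1 = 1 - p*x^2" and "f2 = 1 - p^2*x^2"
      and "u = v - b"
  have n: "a0 \<noteq> 0" "a1 \<noteq> 0" "a2 \<noteq> 0" "a3 \<noteq> 0" "d1 \<noteq> 0" "e0 \<noteq> 0" "f1 \<noteq> 0" "f2 \<noteq> 0" "u \<noteq> 0"
    using nzs by (simp_all add: a0_def a1_def a2_def a3_def d0_def d1_def e0_def f1_def f2_def u_def)
  have id: "(1 - b*x^4) * (p*a2*a1*a0*e0 - (v*p^2 - x)*(v*p - x)*(v - x)*d0)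
   = (v^2*p^2 - 1) * ((v*p^2 - x)*(1 - b*x^2)*(1 - b*p*x^2)*x^2*a0 - (1 - x^2)*(p - x^2)*d0*e0)"
    unfolding a0_def a1_def a2_def a3_def d0_def d1_def e0_def f1_def f2_def by (rule shift_a_identity)
  have step: "(p*u*((1 - b*x^4)*F K) + (1 - b*x^4) * ((1 - b*v*p^2) * H K)) * (a2*a1*a0*e0)
    = u * F K * ((1 - b*x^4) * (p*a2*a1*a0*e0 - (v*p^2 - x)*(v*p - x)*(v - x)*d0))"
    unfolding Hk unfolding a0_def[symmetric] a1_def[symmetric] a2_def[symmetric] d0_def[symmetric] e0_def[symmetric] u_def[symmetric]
    using n by (simp add: field_simps)
  \<comment> \<open>The boundary factor at K + 1 is p times \<open>1 - p*x^2\<close>, which cancels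
    a denominator factor of the term ratio.\<close>
  have pp: "p - p^2*x^2 = p*f1" by (simp add: f1_def algebra_simps power2_eq_square)
  have "u * (v^2*p^2-1) * f2 * (p*f1) * d1 * F (Suc K) / (a3*a2*a1) 
      = u * (v^2*p^2-1) * F K * ((v*p^2 - x)*(1 - b*x^2)*(1 - b*p*x^2)*x^2*a0) / (a2*a1*a0*e0)"
    unfolding F' a3_def[symmetric] d1_def[symmetric] e0_def[symmetric] f1_def[symmetric] f2_def[symmetric]
    using n nz by (simp add: divide_simps)
  also have "\<dots> = (u * F K * ((v^2*p^2-1) * ((v*p^2 - x)*(1 - b*x^2)*(1 - b*p*x^2)*x^2*a0 - (1 - x^2)*(p - x^2)*d0*e0)) / (a2*a1*a0*e0)
      + u * (v^2*p^2-1) * (1 - x^2) * (p - x^2) * d0 * F K / (a2*a1*a0))"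
    using n by (simp add: divide_simps) (simp add: algebra_simps)
  also have "u * F K * ((v^2*p^2-1) * ((v*p^2 - x)*(1 - b*x^2)*(1 - b*p*x^2)*x^2*a0 - (1 - x^2)*(p - x^2)*d0*e0)) / (a2*a1*a0*e0)
     = p*u*((1 - b*x^4)*F K) + (1 - b*x^4) * ((1 - b*v*p^2) * H K)"
    unfolding id[symmetric] step[symmetric] using n by simp
  finally have fin: "u * (v^2*p^2-1) * f2 * (p*f1) * d1 * F (Suc K) / (a3*a2*a1) =
     p*u*((1 - b*x^4)*F K) + (1 - b*x^4) * ((1 - b*v*p^2) * H K) + u * (v^2*p^2-1) * (1 - x^2) * (p - x^2) * d0 * F K / (a2*a1*a0)" .
  define S T where "S = (\<Sum>k<K. (1 - b*p^(4*k)) * F k)" and "T = (\<Sum>k<K. (1 - b*p^(4*k)) * H k)"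
  have split: "p*u*(S + y*f) + w*(T + y*h) = p*u*(y*f) + y*(w*h) + (p*u*S + w*T)" for y f w h
    by (simp add: algebra_simps)
  have IH: "p*u*S + (1 - b*v*p^2)*T = u * (v^2*p^2-1) * (1 - x^2) * (p - x^2) * d0 * F K / (a2*a1*a0)"
    using Suc unfolding P a0_def a1_def a2_def d0_def u_def S_def T_def .
  show ?case
    unfolding sum.lessThan_Suc S_def[symmetric] T_def[symmetric] P u_def[symmetric] split IH pp
      a1_def[symmetric] a2_def[symmetric] a3_def[symmetric] d1_def[symmetric] f2_def[symmetric]
    by (rule fin[symmetric])
qed

text \<open>Replacing a by \<open>p / a\<close> exchanges the two numerator factors that contain a,
  and likewise the two denominator factors.\<close>

lemma cubic_ratio_swap:
  assumes "a \<noteq> 0" "p \<noteq> 0"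
  shows "cubic_ratio p (p / a) b x = cubic_ratio p a b x"
proof -
  have 1: "p / a * x = p * x / a" "p * x / (p / a) = a * x" 
     "b * p^3 * x^3 / (p / a) = a * b * p^2 * x^3" "p / a * b * p^2 * x^3 = b * p^3 * x^3 / a"
    using assms by (simp_all add: field_simps power_numeral_reduce)
  show ?thesis unfolding cubic_ratio_def 1 by (simp add: mult_ac)
qed

lemma cubic_coeff_swap: "a \<noteq> 0 \<Longrightarrow> p \<noteq> 0 \<Longrightarrow> cubic_coeff p (p / a) b k = cubic_coeff p a b k"
  by (simp add: cubic_coeff_def cubic_ratio_swap)

lemma qpoch_0 [simp]: "qpoch x q 0 = 1" by (simp add: qpoch_def)
lemma qpoch_Suc: "qpoch x q (Suc k) = qpoch x q k * (1 - x * q ^ k)" by (simp add: qpoch_def)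

lemma summand_eq_cubic_coeff:
  fixes a q :: "'a::field"
  shows "(qpoch (a * q) (q ^ 2) k * qpoch (q / a) (q ^ 2) k * qpoch q (q ^ 2) (2 * k)) /
        (qpoch (q ^ 2) (q ^ 2) (2 * k) * qpoch (a * q ^ 6) (q ^ 6) k * qpoch (q ^ 6 / a) (q ^ 6) k) *
        q ^ (2 * k ^ 2) = cubic_coeff (q^2) (a * q) q k"
proof (cases "q = 0")
  case True
  then show ?thesis by (cases k) (auto simp: cubic_coeff_def cubic_ratio_def zero_power)
next
  case False
  note q = False
  show ?thesis
  proof (induction k)
    case (Suc k)
    define x where "x = q^(2*k)"
    have X: "(q^2)^k = x" "(q^2)^(2*k) = x^2" "(q^2)^(Suc (2*k)) = q^2*x^2" "(q^6)^k = x^3"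
      "q^(2 * (Suc k)^2) = q^(2*k^2) * (q^2 * x^2)"
      by (simp_all add: x_def flip: power_mult power_add) (simp_all add: power2_eq_square algebra_simps power_add)
    have Y: "2 * Suc k = Suc (Suc (2*k))" by simp
    have R: "cubic_ratio (q^2) (a*q) q x = ((1 - a*q*x) * (1 - q/a*x) * (1 - q*x^2) * (1 - q*(q^2*x^2))) /
      ((1 - q^2*x^2)*(1 - q^2*(q^2*x^2))*(1 - a*q^6*x^3) * (1 - q^6/a*x^3)) * (q^2*x^2)"
    proof -
      have 1: "q^2 * x / (a*q) = q/a*x" "q*(q^2)^3*x^3/(a*q) = q^6/a*x^3" "a*q*q*(q^2)^2*x^3 = a*q^6*x^3" 
         "q * q^2 * x^2 = q*(q^2*x^2)" "(q^2)^2*x^2 = q^2*(q^2*x^2)"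
        using q by (simp_all add: field_simps power_numeral_reduce)
      show ?thesis unfolding cubic_ratio_def 1 by (simp add: mult_ac)
    qed
    show ?case unfolding cubic_coeff_Suc Suc[symmetric] Y qpoch_Suc X R
      by (simp add: mult_ac)
  qed simp
qed

lemma cubic_coeff_eq_0: "cubic_ratio p a b (p ^ j) = 0 \<Longrightarrow> j < k \<Longrightarrow> cubic_coeff p a b k = 0"
  unfolding cubic_coeff_def by (rule prod_zero) auto

text \<open>The parameter is the inverse of the j-th power of \<open>q^2\<close> for j = (n - 1) /
  2, so the ratio has the factor 0 at index j.\<close>

lemma cubic_coeff_terminates:
  fixes q :: "'a::field"
  assumes "q \<noteq> 0" "odd n" "n < 2 * k"
  shows "cubic_coeff (q^2) (1 / q^(n-1)) b k = 0"
proof (rule cubic_coeff_eq_0)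
  from assms obtain j where j: "n = 2*j+1" by (auto elim: oddE)
  then show "(n - 1) div 2 < k" using assms by simp
  show "cubic_ratio (q\<^sup>2) (1 / q ^ (n - 1)) b ((q\<^sup>2) ^ ((n - 1) div 2)) = 0"
    unfolding cubic_ratio_def using j assms by (simp flip: power_mult)
qed

lemma not_root_of_unity_neg:
  fixes q :: "'a::field"
  assumes "\<And>j. j > 0 \<Longrightarrow> q^j \<noteq> 1"
  shows "q ^ Suc j \<noteq> -1"
proof
  assume "q ^ Suc j = -1"
  then have "q ^ (Suc j * 2) = 1" unfolding power_mult by simp
  then show False using assms[of "Suc j * 2"] by simp
qed

lemma not_root_of_unity_neq:
  fixes q :: "'a::field"
  assumes q0: "q \<noteq> 0" and q1: "\<And>j. j > 0 \<Longrightarrow> q^j \<noteq> 1" and "i \<noteq> j"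
  shows "q ^ i \<noteq> q ^ j"
proof -
  have *: "q^i \<noteq> q^j" if "i < j" for i j
  proof
    assume "q^i = q^j"
    also have "q^j = q^i * q^(j-i)" using that by (simp flip: power_add)
    finally show False using q1[of "j-i"] q0 that by simp
  qed
  show ?thesis using *[of i j] *[of j i] assms(3) by (metis nat_neq_iff)
qed

lemma coprime_6_nat:
  fixes n :: nat
  shows "coprime n 6 \<longleftrightarrow> odd n \<and> \<not> 3 dvd n"
proof -
  have "coprime n (2 * 3) \<longleftrightarrow> coprime n 2 \<and> coprime n 3" by (rule coprime_mult_right_iff)
  moreover have "coprime n 2 \<longleftrightarrow> odd n" by simp
  moreover have "coprime n 3 \<longleftrightarrow> \<not> 3 dvd n"
    using prime_imp_coprime[of 3 n] coprime_absorb_left[of 3 n] by (auto simp: coprime_commute)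
  ultimately show ?thesis by simp
qed

text \<open>Induction in steps of 6 by the shift of the parameter, starting from n = 1 and n = 5.
  Terms beyond (n - 1) / 2 vanish, so K is any larger bound; this lets the sums for n and n - 6
  share one range.\<close>

lemma terminating_sum:
  fixes q :: "'a::field"
  assumes q0: "q \<noteq> 0" and q1: "\<And>j. j > 0 \<Longrightarrow> q^j \<noteq> 1"
  shows "coprime n 6 \<Longrightarrow> n < 2 * K \<Longrightarrow>
    (\<Sum>k<K. (1 - q^(8*k+1)) * cubic_coeff (q^2) (1 / q^(n-1)) q k) = of_int (sgn3 n) * (1 - q^n) / q^((n-1) div 2)"
proof (induction n rule: less_induct)
  case (less n)
  have n23: "odd n" "\<not> 3 dvd n"
    using less.prems(1) unfolding coprime_6_nat by auto
  consider "n = 1" | "n = 5" | "n \<ge> 7"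
  proof -
    have "n = 1 \<or> n = 5 \<or> n \<ge> 7" using n23 by presburger
    then show ?thesis using that by blast
  qed
  then show ?case
  proof cases
    case 1
    have z: "cubic_coeff (q^2) (1/q^(n-1)) q k = 0" if "k \<ge> 1" for k
      using cubic_coeff_terminates[OF q0 n23(1), of k q] 1 that by simp
    have "(\<Sum>k<K. (1 - q^(8*k+1)) * cubic_coeff (q^2) (1 / q^(n-1)) q k) = (\<Sum>k\<in>{0}. (1 - q^(8*k+1)) * cubic_coeff (q^2) (1 / q^(n-1)) q k)"
      using less.prems 1 z by (intro sum.mono_neutral_right) auto
    then show ?thesis using 1 by (simp add: sgn3_def)
  next
    case 2
    have nz: "1 - q^2 \<noteq> 0" "1 - q^4 \<noteq> 0" "1 - q^6 \<noteq> 0" "1 - q^7 \<noteq> 0" "1 - q^8 \<noteq> 0" "1 - q^11 \<noteq> 0" "1 - q^17 \<noteq> 0" "1 - q \<noteq> 0"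
      using q1[of 1] q1[of 2] q1[of 4] q1[of 6] q1[of 7] q1[of 8] q1[of 11] q1[of 17] by auto
    have q2: "q^2 \<noteq> 0" using q0 by simp
    have z: "cubic_coeff (q^2) (1/q^(n-1)) q k = 0" if "k \<ge> 3" for k
      using cubic_coeff_terminates[OF q0 n23(1), of k q] 2 that by simp
    have "(\<Sum>k<K. (1 - q^(8*k+1)) * cubic_coeff (q^2) (1 / q^(n-1)) q k) = (\<Sum>k<3. (1 - q^(8*k+1)) * cubic_coeff (q^2) (1 / q^(n-1)) q k)"
      using less.prems 2 z by (intro sum.mono_neutral_right) auto
    \<comment> \<open>Three terms survive for n = 5. The parameter \<open>1 / q^4\<close> is written
      with v = 1 so that \<open>cubic_ratio_low\<close> applies.\<close>
    also have "\<dots> = (1 - q) + (1 - q^9) * cubic_ratio (q^2) (1/(1*(q^2)^2)) q 1 + (1-q^17) * (cubic_ratio (q^2) (1/(1*(q^2)^2)) q 1 * cubic_ratio (q^2) (1/(1*(q^2)^2)) q (q^2))"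
    proof -
      have 3: "(\<Sum>k<3. f k) = f 0 + f 1 + f 2" for f :: "nat \<Rightarrow> 'a" by (simp add: numeral_3_eq_3 numeral_2_eq_2)
      have g: "cubic_coeff p a b 1 = cubic_ratio p a b 1" "cubic_coeff p a b 2 = cubic_ratio p a b 1 * cubic_ratio p a b p" for p a b :: 'a
        by (simp_all add: cubic_coeff_def numeral_2_eq_2)
      show ?thesis unfolding 3 g using 2 by simp
    qed
    also have "cubic_ratio (q^2) (1/(1*(q^2)^2)) q 1 = - (1 - q^6)*(1-q^3) / (q^2*(1-q^11)*(1-q^2))"
    proof -
      have e: "1*(q^2)^2 - 1 = - (1 - q^4)" "1 - 1*1*(q^2)^3 = 1 - q^6" "1 - q*1^2 = 1 - q" "1 - q*q^2*1^2 = 1 - q^3" 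
        "1 - q*1*(q^2)^5*1^3 = 1 - q^11" "1 - q*1^3 = 1 - q" "1 - q^2*1^2 = 1 - q^2" "1 - (q^2)^2*1^2 = 1 - q^4"
        by (simp_all add: power_numeral_reduce)
      have "- A4 * A6 * A1 * A3 * 1^2 / (d * A11 * A1 * A2 * A4) = - A6*A3/(d*A11*A2)" if "A1 \<noteq> 0" "A4 \<noteq> 0"
        for A1 A2 A3 A4 A6 A11 d :: 'a using that by simp
      then show ?thesis unfolding cubic_ratio_low[OF one_neq_zero q2] e using nz by blast
    qed
    also have "cubic_ratio (q^2) (1/(1*(q^2)^2)) q (q^2) = - (1 - q^2)*(1-q^5)*q^4 / ((1-q^17)*(1-q^6))"
    proof -
      have e: "1*(q^2)^2 - q^2 = - (q^2) * (1 - q^2)" "1 - q^2*1*(q^2)^3 = 1 - q^8" "1 - q*(q^2)^2 = 1 - q^5" "1 - q*q^2*(q^2)^2 = 1 - q^7" 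
        "1 - q*1*(q^2)^5*(q^2)^3 = 1 - q^17" "1 - q*(q^2)^3 = 1 - q^7" "1 - q^2*(q^2)^2 = 1 - q^6" "1 - (q^2)^2*(q^2)^2 = 1 - q^8"
        by (simp_all add: algebra_simps power_numeral_reduce)
      have "- d * A2 * A8 * A5 * A7 * e / (d * A17 * A7 * A6 * A8) = - A2*A5*e/(A17*A6)" if "A7 \<noteq> 0" "A8 \<noteq> 0" "d \<noteq> 0"
        for A2 A8 A5 A7 A17 A6 d e :: 'a using that by simp
      moreover have "(q^2)^2 = q^4" by simp
      ultimately show ?thesis unfolding cubic_ratio_low[OF one_neq_zero q2] e using nz q2 by metis
    qed
    also have "(1 - q) + (1 - q^9) * (- (1 - q^6)*(1-q^3) / (q^2*(1-q^11)*(1-q^2))) + (1-q^17) * (- (1 - q^6)*(1-q^3) / (q^2*(1-q^11)*(1-q^2)) * (- (1 - q^2)*(1-q^5)*q^4 / ((1-q^17)*(1-q^6))))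
       = - (1 - q^5)/q^2"
    proof -
      have 6: "1 - q^6 = (1 - q^2)*(1 + q^2 + q^4)" by (simp add: algebra_simps power_numeral_reduce)
      have gen: "u + n9 * (- (A*B)*n3 / (d*n11*A)) + n17 * (- (A*B)*n3 / (d*n11*A) * (- A*n5*e / (n17*(A*B))))
          = (u*n11*d - n9*B*n3 + n3*n5*e) / (d*n11)"
        if "d \<noteq> 0" "n11 \<noteq> 0" "A \<noteq> 0" "A*B \<noteq> 0" "n17 \<noteq> 0" for u n9 A B n3 d n11 n17 n5 e :: 'a
      proof -
        have "u + n9 * (- (A*B)*n3 / (d*n11*A)) + n17 * (- (A*B)*n3 / (d*n11*A) * (- A*n5*e / (n17*(A*B))))
          = u + - n9*B*n3/(d*n11) + n3*n5*e/(d*n11)" using that by (simp add: mult_ac)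
        also have "\<dots> = (u*n11*d - n9*B*n3 + n3*n5*e) / (d*n11)" using that by (simp add: add_divide_distrib diff_divide_distrib mult_ac)
        finally show ?thesis .
      qed
      have "(1 - q)*(1 - q^11)*q^2 - (1 - q^9)*(1+q^2+q^4)*(1-q^3) + (1-q^3)*(1-q^5)*q^4 = - (1-q^5)*(1-q^11)"
        by (simp add: algebra_simps power_numeral_reduce)
      then show ?thesis unfolding 6 using gen[of "q^2" "1-q^11" "1-q^2" "1+q^2+q^4" "1-q^17" "1-q" "1-q^9" "1-q^3" "1-q^5" "q^4"] nz q2
        by (simp add: 6)
    qed
    finally show ?thesis using 2 by (simp add: sgn3_def)
  next
    case 3
    define m where "m = n - 6"
    have m1: "n = m + 6" "m \<ge> 1" using 3 by (simp_all add: m_def)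
    have "odd m" using n23 m1 by simp
    moreover have "\<not> 3 dvd m" using n23 unfolding m1(1) by presburger
    ultimately have m: "n = m + 6" "m \<ge> 1" "odd m" "\<not> 3 dvd m" using m1 by auto
    have cm: "coprime m 6"
      using m by (simp add: coprime_6_nat)
    \<comment> \<open>With this v the lower parameter \<open>1 / (v*p^2)\<close> is
      \<open>1 / q^(n-1)\<close> and the upper one \<open>p / v\<close> is
      \<open>1 / q^(m-1)\<close>, which links n to m = n - 6.\<close>
    define p v where "p = q^2" and "v = q^(m+1)"
    have pk: "p^k = q^(2*k)" for k by (simp add: p_def flip: power_mult)
    note neq = not_root_of_unity_neq[OF q0 q1]
    have nz: "v \<noteq> 0" "p \<noteq> 0" using q0 by (simp_all add: v_def p_def)
    have v1: "p^k*v \<noteq> 1" for k unfolding pk v_def power_add[symmetric] by (rule q1) simp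
    \<comment> \<open>Parity enters here: m + 1 is even and 6 * k + 1 is odd.\<close>
    have vb: "v \<noteq> q*p^(3*k)" for k
      unfolding pk v_def power_Suc[symmetric] by (rule neq) (use m(3) in auto)
    have bv: "q*v*p^(3*k+2) \<noteq> 1" for k
      unfolding pk v_def power_Suc[symmetric] power_add[symmetric] by (rule q1) simp
    have p1: "p^Suc k \<noteq> 1" for k unfolding pk by (rule q1) simp
    have a1: "1 / (v*p^2) = 1 / q^(n-1)" unfolding v_def pk power_add[symmetric] m by simp
    have a2: "p / v = 1 / q^(m-1)"
    proof -
      have "q^(m+1) = q^2 * q^(m-1)" using m by (simp flip: power_add power_Suc)
      then show ?thesis using q0 by (simp add: p_def v_def)
    qed
    define S where "S = (\<lambda>n. (\<Sum>k<K. (1 - q^(8*k+1)) * cubic_coeff (q^2) (1 / q^(n-1)) q k))"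
    have SS: "S n = (\<Sum>k<K. (1 - q*p^(4*k)) * cubic_coeff p (1 / q^(n-1)) q k)" for n
      unfolding S_def pk by (simp add: p_def)
    \<comment> \<open>The boundary term of the telescoping contains the coefficient at K, which is 0
      since n < 2 * K.\<close>
    have "p*(v - q) * S n + (1 - q*v*p^2) * S m = 0"
      unfolding SS a1[symmetric] a2[symmetric] shift_a_telescope[OF nz v1 vb bv p1]
      unfolding a1 unfolding p_def cubic_coeff_terminates[OF q0 n23(1) less.prems(2)] by simp
    moreover have "S m = of_int (sgn3 m) * (1 - q^m) / q^((m-1) div 2)"
      unfolding S_def using less.IH[of m] m cm less.prems by simp
    moreover have "sgn3 m = sgn3 n" using m by (simp add: sgn3_def mod_add_eq [symmetric, of m 6])
    moreover have "(n-1) div 2 = (m-1) div 2 + 3" using m by simp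
    moreover have "q*v*p^2 = q^n" unfolding v_def pk m(1) by (simp add: power_add mult_ac power_numeral_reduce)
    moreover have "v - q = - q * (1 - q^m)" unfolding v_def by (simp add: algebra_simps)
    ultimately have "q^3 * (1 - q^m) * S n = (1 - q^n) * of_int (sgn3 n) * (1 - q^m) / q^((m-1) div 2)"
      by (simp add: p_def power_numeral_reduce mult_ac)
    moreover have "1 - q^m \<noteq> 0" using q1[of m] m by simp
    ultimately have "q^3 * S n = (1 - q^n) * of_int (sgn3 n) / q^((m-1) div 2)"
      using mult_left_cancel[of "1 - q^m" "q^3 * S n" "(1 - q^n) * of_int (sgn3 n) / q^((m-1) div 2)"] by (simp add: mult_ac)
    then have "S n = of_int (sgn3 n) * (1 - q^n) / q^((n-1) div 2)"
      unfolding \<open>(n-1) div 2 = _\<close> power_add using q0 by (simp add: divide_simps mult_ac)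
    then show ?thesis by (simp add: S_def)
  qed
qed

section \<open>The shift in b and sums at roots of unity\<close>

text \<open>The certificate for the shift of b, with denominators cleared. The inverse of a is a
  separate variable c, so that the identity lives in a ring; \<open>a * c = 1\<close> enters only
  through two products.\<close>

lemma shift_b_identity:
  fixes x p a c b :: "'a::comm_ring_1"
  assumes "a * c = 1"
  shows "(1 - b*p)*(1 - b*x^4)*((1 - b*p^3*x^3*c)*(1 - a*b*p^2*x^3)) - (1 - b*p^3*x^4)*(1 - b*x^2)*(1 - b*p*x^2)*(1 - b*p^2*x^2)
   = b*p^2*x^2*(1 - a*x)*(1 - p*x*c)*(1 - b*x^2)*(1 - b*p*x^2) - b*(1 - x^2)*(p - x^2)*((1 - b*p^3*x^3*c)*(1 - a*b*p^2*x^3))"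
proof -
  have "(1 - b*p^3*x^3*c)*(1 - a*b*p^2*x^3) = 1 - b*p^3*x^3*c - a*b*p^2*x^3 + (a*c)*(b^2*p^5*x^6)"
    by (simp add: algebra_simps power_numeral_reduce)
  then have D: "(1 - b*p^3*x^3*c)*(1 - a*b*p^2*x^3) = 1 - b*p^3*x^3*c - a*b*p^2*x^3 + b^2*p^5*x^6"
    unfolding assms by simp
  have "(1 - a*x)*(1 - p*x*c) = 1 - a*x - p*x*c + (a*c)*(p*x^2)"
    by (simp add: algebra_simps power_numeral_reduce)
  then have E: "(1 - a*x)*(1 - p*x*c) = 1 - a*x - p*x*c + p*x^2"
    unfolding assms by simp
  have "b*p^2*x^2*(1 - a*x)*(1 - p*x*c)*(1 - b*x^2)*(1 - b*p*x^2) = b*p^2*x^2*((1 - a*x)*(1 - p*x*c))*(1 - b*x^2)*(1 - b*p*x^2)"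
    by (simp only: mult.assoc)
  then show ?thesis unfolding D E by (simp add: algebra_simps power_numeral_reduce)
qed

text \<open>
  Here \<open>f k\<close> stands for the summand of the cubic sum at \<open>k + e / 2\<close>, without the factor that is made
  explicit in the conclusion. Only the term ratio enters, so \<open>f\<close> is free up to a constant.
\<close>

lemma vanishing_sum:
  fixes q a c b :: "'a::field" and f :: "nat \<Rightarrow> 'a" and e d :: nat
  assumes ac: "a * c = 1" and q0: "q \<noteq> 0" and aq: "\<And>i j. a * q^i \<noteq> q^j"
    and ord: "\<And>j. 0 < j \<Longrightarrow> j < d \<Longrightarrow> (q^2)^j \<noteq> 1" and d: "1 < d" and e: "e \<le> 1"
  shows "M < d \<Longrightarrow> M mod 3 \<noteq> 1 \<Longrightarrow> b * q^(2*M) = 1 \<Longrightarrow> (\<And>k. M < 2*k+e \<Longrightarrow> f k = 0) \<Longrightarrow>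
     (\<And>k x. x = q^(2*k+e) \<Longrightarrow> f (Suc k) * ((1 - b*(q^2)^3*x^3*c) * (1 - a*b*(q^2)^2*x^3) * (1 - q^2*x^2) * (1 - (q^2)^2*x^2))
        = f k * ((1 - a*x) * (1 - q^2*x*c) * (1 - b*x^2) * (1 - b*q^2*x^2) * (q^2*x^2))) \<Longrightarrow>
     M < 2*K+e \<Longrightarrow> (\<Sum>k<K. f k * (1 - b * (q^(2*k+e))^4)) = 0"
proof (induction M arbitrary: f b K rule: less_induct)
  case (less M f b K)
  define p where "p = q^2"
  define X where "X = (\<lambda>k. q^(2*k+e))"
  define D where "D = (\<lambda>x. (1 - b*p^3*x^3*c) * (1 - a*b*p^2*x^3))"
  note z = less.prems(4)
  have ratio: "f (Suc k) * (D (X k) * (1 - p*(X k)^2) * (1 - p^2*(X k)^2))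
        = f k * ((1 - a*X k) * (1 - p*X k*c) * (1 - b*(X k)^2) * (1 - b*p*(X k)^2) * (p*(X k)^2))" for k
    using less.prems(5)[of "X k" k] by (simp add: X_def p_def D_def)
  have XS: "X (Suc k) = p * X k" for k by (simp add: X_def p_def power2_eq_square)
  have bM: "b * q^(2*M) = 1" by (rule less.prems(3))
  have pX: "p^i * (X k)^j = q^(2*i + (2*k+e)*j)" for i j k
    unfolding p_def X_def by (simp only: power_mult[symmetric] power_add[symmetric])
  \<comment> \<open>Since b is the inverse of \<open>q^(2*M)\<close>, a zero of this factor would
    make a a quotient of powers of q, against \<open>aq\<close>. The other denominator factor is
    treated alike.\<close>
  have D1: "1 - b*p^3*(X k)^3*c \<noteq> 0" for k
  proof
    assume "1 - b*p^3*(X k)^3*c = 0"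
    then have 1: "b*p^3*(X k)^3*c = 1" by simp
    have "a * q^(2*M) = (b*p^3*(X k)^3*c) * (a * q^(2*M))" unfolding 1 by simp
    also have "\<dots> = (a*c) * (b*q^(2*M)) * (p^3 * (X k)^3)" by (simp only: mult_ac)
    also have "\<dots> = q^(2*3 + (2*k+e)*3)" unfolding ac bM pX by simp
    finally show False using aq by blast
  qed
  have D2: "1 - a*b*p^2*(X k)^3 \<noteq> 0" for k
  proof
    assume "1 - a*b*p^2*(X k)^3 = 0"
    then have 1: "a*b*p^2*(X k)^3 = 1" by simp
    have "a * q^(2*2 + (2*k+e)*3) = a * (p^2*(X k)^3)" unfolding pX ..
    also have "\<dots> = (b*q^(2*M)) * (a * (p^2*(X k)^3))" unfolding bM by simp
    also have "\<dots> = (a*b*p^2*(X k)^3) * q^(2*M)" by (simp only: mult_ac)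
    also have "\<dots> = q^(2*M)" unfolding 1 by simp
    finally show False using aq by blast
  qed
  have Dn: "D (X k) \<noteq> 0" for k using D1 D2 by (simp add: D_def)
  \<comment> \<open>Up to a constant, g is the summand with b replaced by \<open>b*p^3\<close>; H is
    the certificate of this shift.\<close>
  define g where "g = (\<lambda>k. f k * ((1 - b*(X k)^2) * (1 - b*p*(X k)^2) * (1 - b*p^2*(X k)^2)) / D (X k))"
  define H where "H = (\<lambda>k. b*(1 - (X k)^2)*(p - (X k)^2)*f k)"
  \<comment> \<open>\<open>X 0\<close> is \<open>q^e\<close>, so \<open>1 - (X 0)^2\<close> vanishes
    for e = 0 and \<open>p - (X 0)^2\<close> for e = 1: the lower boundary value is 0 for integers
    and for half-integers.\<close>
  have H0: "H 0 = 0" using e by (cases e) (auto simp: H_def X_def p_def)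
  have HS: "H (Suc k) = f k * (b*p^2*(X k)^2*(1 - a*X k)*(1 - p*X k*c)*(1 - b*(X k)^2)*(1 - b*p*(X k)^2)) / D (X k)" for k
  proof -
    have "H (Suc k) * D (X k) = b * p * (f (Suc k) * (D (X k) * (1 - p*(X k)^2) * (1 - p^2*(X k)^2)))"
      by (simp add: H_def XS power_mult_distrib algebra_simps power_numeral_reduce)
    also have "\<dots> = f k * (b*p^2*(X k)^2*(1 - a*X k)*(1 - p*X k*c)*(1 - b*(X k)^2)*(1 - b*p*(X k)^2))"
      unfolding ratio by (simp add: mult_ac power2_eq_square)
    finally show ?thesis using Dn[of k] by (simp add: nonzero_eq_divide_eq)
  qed
  have step: "(1 - b*p) * (f k * (1 - b*(X k)^4)) - g k * (1 - b*p^3*(X k)^4) = H (Suc k) - H k" for k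
  proof -
    define x where "x = X k"
    have "(1 - b*p) * (f k * (1 - b*x^4)) - g k * (1 - b*p^3*x^4)
      = f k * ((1 - b*p)*(1 - b*x^4)*D x - (1 - b*p^3*x^4)*(1 - b*x^2)*(1 - b*p*x^2)*(1 - b*p^2*x^2)) / D x"
      using Dn[of k] by (simp add: g_def x_def[symmetric] diff_divide_distrib right_diff_distrib mult_ac)
    also have "\<dots> = f k * (b*p^2*x^2*(1 - a*x)*(1 - p*x*c)*(1 - b*x^2)*(1 - b*p*x^2) - b*(1 - x^2)*(p - x^2)*D x) / D x"
      unfolding D_def shift_b_identity[OF ac] ..
    also have "\<dots> = H (Suc k) - H k"
      unfolding HS using Dn[of k] by (simp add: H_def x_def[symmetric] diff_divide_distrib right_diff_distrib mult_ac)
    finally show ?thesis by (simp add: x_def)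
  qed
  have fK: "f K = 0" using z less.prems(6) by simp
  have "(\<Sum>k<K. (1 - b*p) * (f k * (1 - b*(X k)^4)) - g k * (1 - b*p^3*(X k)^4)) = H K - H 0"
    unfolding step by (rule sum_lessThan_telescope)
  also have "\<dots> = 0" using H0 fK by (simp add: H_def)
  finally have tel: "(1 - b*p) * (\<Sum>k<K. f k * (1 - b*(X k)^4)) = (\<Sum>k<K. g k * (1 - b*p^3*(X k)^4))"
    by (simp add: sum_subtractf sum_distrib_left)
  \<comment> \<open>The three factors introduced in g vanish where \<open>2*k+e\<close> is M, M - 1
    or M - 2, so the support of g ends three units before that of f.\<close>
  have gz: "g k = 0" if kM: "M < 2*k+e+3" for k
  proof -
    consider "M < 2*k+e" | "M = 2*k+e" | "M = 2*k+e+1" | "M = 2*k+e+2" using kM by linarith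
    then show ?thesis
    proof cases
      case 1 then show ?thesis using z by (simp add: g_def)
    next
      case 2
      have "b * (p^0 * (X k)^2) = 1" using bM unfolding pX 2 by (simp add: mult.commute)
      then show ?thesis by (simp add: g_def)
    next
      case 3
      have "2*1 + (2*k+e)*2 = 2*M" using 3 by simp
      then have "b * (p^1 * (X k)^2) = 1" using bM unfolding pX by simp
      then show ?thesis by (simp add: g_def mult.assoc)
    next
      case 4
      have "2*2 + (2*k+e)*2 = 2*M" using 4 by simp
      then have "b * (p^2 * (X k)^2) = 1" using bM unfolding pX by simp
      then show ?thesis by (simp add: g_def mult.assoc)
    qed
  qed
  have "(\<Sum>k<K. g k * (1 - b*p^3*(X k)^4)) = 0"
  \<comment> \<open>For M < 3 no term of g survives. Otherwise the induction hypothesis applies to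
    \<open>b*p^3\<close> and M - 3, which is in the same class modulo 3.\<close>
  proof (cases "M < 3")
    case True
    then show ?thesis using gz by simp
  next
    case False
    then obtain N where N: "M = N + 3" by (metis add.commute le_Suc_ex not_less)
    have "(\<Sum>k<K. g k * (1 - b*p^3*(q^(2*k+e))^4)) = 0"
    proof (rule less.IH[of N "b*p^3" g K])
      show "N < M" "N < d" "N < 2*K+e" using N less.prems by auto
      show "N mod 3 \<noteq> 1" using less.prems(2) N by simp
      show "b * p^3 * q^(2*N) = 1" 
      proof -
        have "b * p^3 * q^(2*N) = b * q^(2*3 + 2*N)" by (simp only: p_def power_mult[symmetric] power_add mult.assoc)
        also have "2*3 + 2*N = 2*M" using N by simp
        finally show ?thesis using bM by simp
      qed
      show "g k = 0" if "N < 2*k+e" for k using gz that N by simp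
      fix k x
      assume x': "x = q^(2*k+e)"
      have x: "X k = x" using x' by (simp add: X_def)
      define u v where "u = (1 - b*p^2*x^2)*(1 - b*p^3*x^2)*(1 - b*p^4*x^2)" and "v = (1 - b*p^6*x^3*c)*(1 - a*b*p^5*x^3)"
      have dn: "D x \<noteq> 0" "v \<noteq> 0" using Dn[of k] Dn[of "Suc k"] by (auto simp: XS x D_def v_def power_mult_distrib mult_ac power_numeral_reduce)
      have gS: "g (Suc k) = f (Suc k) * u / v"
        by (simp add: g_def XS x D_def v_def u_def power_mult_distrib mult_ac power_numeral_reduce)
      have "g (Suc k) * (v * (1 - p*x^2) * (1 - p^2*x^2)) * D x = f (Suc k) * (D x * (1 - p*x^2) * (1 - p^2*x^2)) * u"
        unfolding gS using dn by (simp add: mult_ac)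
      also have "\<dots> = f k * ((1 - b*x^2) * (1 - b*p*x^2) * (1 - b*p^2*x^2)) * ((1 - a*x) * (1 - p*x*c) * (1 - b*p^3*x^2) * (1 - b*p^4*x^2) * (p*x^2))"
        using ratio[of k] by (simp add: x u_def mult_ac)
      also have "f k * ((1 - b*x^2) * (1 - b*p*x^2) * (1 - b*p^2*x^2)) = g k * D x"
        using dn by (simp add: g_def x)
      finally have "g (Suc k) * (v * (1 - p*x^2) * (1 - p^2*x^2)) * D x
          = g k * ((1 - a*x) * (1 - p*x*c) * (1 - b*p^3*x^2) * (1 - b*p^4*x^2) * (p*x^2)) * D x"
        by (simp only: mult_ac)
      then have "g (Suc k) * (v * (1 - p*x^2) * (1 - p^2*x^2)) = g k * ((1 - a*x) * (1 - p*x*c) * (1 - b*p^3*x^2) * (1 - b*p^4*x^2) * (p*x^2))"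
        using dn by simp
      then show "g (Suc k) * ((1 - b*p^3*(q^2)^3*x^3*c) * (1 - a*(b*p^3)*(q^2)^2*x^3) * (1 - q^2*x^2) * (1 - (q^2)^2*x^2))
        = g k * ((1 - a*x) * (1 - q^2*x*c) * (1 - b*p^3*x^2) * (1 - b*p^3*q^2*x^2) * (q^2*x^2))"
        unfolding v_def p_def[symmetric] by (simp add: mult_ac power_numeral_reduce)
    qed
    then show ?thesis by (simp add: X_def)
  qed
  with tel have "(1 - b*p) * (\<Sum>k<K. f k * (1 - b*(X k)^4)) = 0" by simp
  \<comment> \<open>\<open>b * p\<close> is p to the power 1 - M. This is 1 for M = 1, the reason
    for excluding the class of 1 modulo 3; for the other M < d it would contradict
    \<open>ord\<close>.\<close>
  moreover have "1 - b*p \<noteq> 0"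
  proof
    assume "1 - b*p = 0"
    then have bp: "b * p = 1" by simp
    show False
    proof (cases "M = 0")
      case True
      then have "p = 1" using bp less.prems(3) by simp
      then show False using ord[of 1] d by (simp add: p_def)
    next
      case False
      then have M: "M \<ge> 2" using less.prems(2) by (cases "M = 1") auto
      have "q^(2*M) = p * p^(M-1)" using M by (simp add: p_def power_mult power_eq_if[of _ M])
      then have "p^(M-1) = (b * p) * p^(M-1)" using bp by simp
      also have "\<dots> = b * q^(2*M)" using \<open>q^(2*M) = p * p^(M-1)\<close> by (simp add: mult.assoc)
      finally have "p^(M-1) = 1" using bM by simp
      then show False using ord[of "M-1"] M less.prems(1) by (simp add: p_def less_imp_diff_less)
    qed
  qed
  ultimately show ?case by (simp add: X_def)
qed

section \<open>Central Gaussian binomials and their recurrence\<close>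

fun qbin :: "'a::comm_ring_1 \<Rightarrow> nat \<Rightarrow> nat \<Rightarrow> 'a" where
  "qbin q n 0 = 1"
| "qbin q 0 (Suc k) = 0"
| "qbin q (Suc n) (Suc k) = qbin q n k + q ^ Suc k * qbin q n (Suc k)"

lemma one_minus_double:
  fixes q :: "'a::comm_ring_1"
  shows "1 - q^(2*m+2) = (1 - q^Suc m) * (1 + q^Suc m)"
proof -
  have "2*m+2 = Suc m + Suc m" by simp
  then have "q^(2*m+2) = q^Suc m * q^Suc m" by (simp only: power_add)
  then show ?thesis by (simp add: algebra_simps)
qed

text \<open>Pascal's rule makes \<open>qbin\<close> a polynomial in q, defined also where the
  q-factorials vanish; the product formula is therefore division-free.\<close>

lemma qbin_prod:
  fixes q :: "'a::comm_ring_1"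
  shows "qbin q n k * (\<Prod>i<k. 1 - q ^ Suc i) = (\<Prod>i<k. 1 - q ^ (n - i))"
proof (induction q n k rule: qbin.induct)
  case (2 q k)
  have "(\<Prod>i<Suc k. 1 - q ^ (0 - i)) = 0" by (rule prod_zero[of _ "\<lambda>i. 1 - q ^ (0 - i)"]) auto
  then show ?case by simp
next
  case (3 q n k)
  define F where "F = (\<Prod>i<k. 1 - q ^ (n - i))"
  \<comment> \<open>For n < k the factor at i = n is 1 - q^0 = 0; this covers the range where
    \<open>n - k\<close> is truncated.\<close>
  have Fz: "F = 0" if "n < k"
    unfolding F_def using that by (intro prod_zero) (auto intro!: bexI[of _ n])
  have Fe: "F * (1 - q^Suc k + q^Suc k * (1 - q^(n-k))) = F * (1 - q^Suc n)"
  proof (cases "n < k")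
    case False
    then have "q^Suc k * q^(n-k) = q^Suc n" by (simp flip: power_add power_Suc)
    then show ?thesis by (simp add: right_diff_distrib)
  qed (simp add: Fz)
  have "qbin q (Suc n) (Suc k) * (\<Prod>i<Suc k. 1 - q ^ Suc i)
     = (qbin q n k * (\<Prod>i<k. 1 - q ^ Suc i)) * (1 - q^Suc k) + q^Suc k * (qbin q n (Suc k) * (\<Prod>i<Suc k. 1 - q ^ Suc i))"
    by (simp add: algebra_simps)
  also have "\<dots> = F * (1 - q^Suc k + q^Suc k * (1 - q^(n-k)))"
    unfolding 3 F_def by (simp add: algebra_simps)
  also have "\<dots> = F * (1 - q^Suc n)" by (rule Fe)
  also have "\<dots> = (\<Prod>i<Suc k. 1 - q ^ (Suc n - i))"
    unfolding prod.lessThan_Suc_shift F_def by (simp add: mult.commute)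
  finally show ?case .
qed simp

text \<open>The product formulas of both binomials are compared, cancelling (q; q)_m and 1 -
  q^(m+1); hence q must not be a root of unity.\<close>

lemma qbin_central_Suc_idom:
  fixes q :: "'a::idom"
  assumes q: "\<And>j. q ^ Suc j \<noteq> 1"
  shows "qbin q (2 * Suc m) (Suc m) * (1 - q ^ Suc m) = qbin q (2*m) m * ((1 - q^(2*m+1)) * (1 + q^Suc m))"
proof -
  define P where "P = (\<Prod>i<m. 1 - q ^ Suc i)"
  define F where "F = (\<Prod>i<m. 1 - q ^ (2*m - i))"
  have P: "P \<noteq> 0" using q by (auto simp: P_def)
  have 1: "qbin q (2*m) m * P = F" unfolding P_def F_def by (rule qbin_prod)
  have 2: "qbin q (2*Suc m) (Suc m) * (P * (1 - q^Suc m)) = (\<Prod>i<Suc m. 1 - q ^ (2*Suc m - i))"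
    unfolding P_def using qbin_prod[of q "2*Suc m" "Suc m"] by simp
  have "(\<Prod>i<Suc m. 1 - q ^ (2*Suc m - i)) * (1 - q^Suc m) = (\<Prod>i<Suc (Suc m). 1 - q ^ (2*Suc m - i))"
    unfolding prod.lessThan_Suc[of _ "Suc m"] by simp
  also have "\<dots> = (1 - q^(2*m+2)) * ((1 - q^(2*m+1)) * F)"
    unfolding prod.lessThan_Suc_shift F_def by simp
  also have "1 - q^(2*m+2) = (1 - q^Suc m) * (1 + q^Suc m)"
    by (rule one_minus_double)
  finally have "((\<Prod>i<Suc m. 1 - q ^ (2*Suc m - i)) - (1 + q^Suc m) * ((1 - q^(2*m+1)) * F)) * (1 - q^Suc m) = 0"
    by (simp add: algebra_simps)
  then have "(\<Prod>i<Suc m. 1 - q ^ (2*Suc m - i)) = (1 + q^Suc m) * ((1 - q^(2*m+1)) * F)"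
    using q[of m] by simp
  then have "(qbin q (2 * Suc m) (Suc m) * (1 - q ^ Suc m)) * P = (qbin q (2*m) m * ((1 - q^(2*m+1)) * (1 + q^Suc m))) * P"
    using 2 unfolding 1[symmetric] by (simp only: mult_ac)
  then show ?thesis using P by simp
qed

lemma poly_qbin: "poly (qbin p n k) z = qbin (poly p z) n k"
  by (induction p n k rule: qbin.induct) auto

text \<open>Both sides are polynomials in q. The identity holds for an indeterminate, which is no
  root of unity, and evaluation carries it to every q.\<close>

lemma qbin_central_Suc:
  fixes q :: "'a::idom"
  shows "qbin q (2 * Suc m) (Suc m) * (1 - q ^ Suc m) = qbin q (2*m) m * ((1 - q^(2*m+1)) * (1 + q^Suc m))"
proof -
  have "[:0, 1::'a:] ^ Suc j \<noteq> 1" for j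
  proof
    assume "[:0, 1::'a:] ^ Suc j = 1"
    then have "poly ([:0, 1::'a:] ^ Suc j) 0 = poly 1 0" by simp
    then show False by simp
  qed
  then have "poly (qbin [:0,1::'a:] (2 * Suc m) (Suc m) * (1 - [:0,1:] ^ Suc m)) q
     = poly (qbin [:0,1::'a:] (2*m) m * ((1 - [:0,1:]^(2*m+1)) * (1 + [:0,1:]^Suc m))) q"
    by (subst qbin_central_Suc_idom) auto
  then show ?thesis by (simp add: poly_qbin del: qbin.simps mult_Suc_right)
qed

text \<open>
  This is \<open>(q; q\<^sup>2)\<^sub>m / (q\<^sup>2; q\<^sup>2)\<^sub>m\<close> in a form without a pole at roots of unity of odd order.
\<close>

definition qcen :: "'a::field \<Rightarrow> nat \<Rightarrow> 'a" where
  "qcen q m = qbin q (2*m) m / (\<Prod>j<m. (1 + q ^ Suc j)^2)"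

text \<open>The recurrence of (q; q^2)_m / (q^2; q^2)_m persists at roots of unity of odd order,
  since only factors 1 + q^j are divided out.\<close>

lemma qcen_Suc:
  fixes q :: "'a::field"
  assumes q: "\<And>j. q ^ Suc j \<noteq> -1"
  shows "qcen q (Suc m) * (1 - q^(2*m+2)) = qcen q m * (1 - q^(2*m+1))"
proof -
  define P where "P = (\<Prod>j<m. (1 + q ^ Suc j)^2)"
  define r where "r = 1 + q^Suc m"
  have nz: "1 + q ^ Suc j \<noteq> 0" for j using q[of j] by (metis add.commute add_eq_0_iff)
  have P: "P \<noteq> 0" using nz by (simp add: P_def del: power_Suc)
  have r: "r \<noteq> 0" unfolding r_def by (rule nz)
  have "1 - q^(2*m+2) = (1 - q^Suc m) * r"
    unfolding r_def by (rule one_minus_double)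
  then have "qcen q (Suc m) * (1 - q^(2*m+2)) = (qbin q (2*Suc m) (Suc m) * (1 - q^Suc m)) * r / (P * r^2)"
    by (simp add: qcen_def P_def r_def del: qbin.simps mult_Suc_right power_Suc)
  also have "\<dots> = qbin q (2*m) m * (1 - q^(2*m+1)) * r^2 / (P * r^2)"
    unfolding qbin_central_Suc r_def[symmetric] by (simp add: power2_eq_square mult_ac del: power_Suc)
  also have "\<dots> = qcen q m * (1 - q^(2*m+1))"
    using r by (simp add: qcen_def P_def)
  finally show ?thesis .
qed

text \<open>The summand without [8k+1]. Clearing 1/a from (q/a; q^2)_k and (q^6/a; q^6)_k produces
  equal powers of a, which cancel; \<open>qcen\<close> replaces the quotient of the other two
  products, so roots of unity of odd order cause no pole there.\<close>

definition regular_term :: "'a::field \<Rightarrow> 'a \<Rightarrow> nat \<Rightarrow> 'a" where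
  "regular_term q a k = (\<Prod>j<k. (1 - a * q^(2*j+1)) * (a - q^(2*j+1)) / ((1 - a * q^(6*j+6)) * (a - q^(6*j+6)))) * qcen q (2*k) * q^(2*k^2)"

lemma regular_term_Suc:
  fixes a q :: "'a::field"
  assumes q: "\<And>j. q ^ Suc j \<noteq> -1" and a: "1 - a * q^(6*k+6) \<noteq> 0" "a - q^(6*k+6) \<noteq> 0"
  shows "regular_term q a (Suc k) * ((1 - a * q^(6*k+6)) * (a - q^(6*k+6)) * (1 - q^(4*k+2)) * (1 - q^(4*k+4)))
    = regular_term q a k * ((1 - a * q^(2*k+1)) * (a - q^(2*k+1)) * (1 - q^(4*k+1)) * (1 - q^(4*k+3)) * q^(4*k+2))"
proof -
  define P where "P = (\<Prod>j<k. (1 - a * q^(2*j+1)) * (a - q^(2*j+1)) / ((1 - a * q^(6*j+6)) * (a - q^(6*j+6))))"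
  define d0 d1 w where "d0 = 1 - a * q^(6*k+6)" and "d1 = a - q^(6*k+6)" and "w = (1 - a * q^(2*k+1)) * (a - q^(2*k+1))"
  have e: "q^(2*(Suc k)^2) = q^(2*k^2) * q^(4*k+2)"
  proof -
    have "2*(Suc k)^2 = 2*k^2 + (4*k+2)" by (simp add: power2_eq_square)
    then show ?thesis by (simp only: power_add)
  qed
  have c: "qcen q (2*Suc k) * ((1 - q^(4*k+2)) * (1 - q^(4*k+4))) = qcen q (2*k) * ((1 - q^(4*k+1)) * (1 - q^(4*k+3)))"
  proof -
    have ar: "2 * Suc (2*k) + 2 = 4*k+4" "2 * Suc (2*k) + 1 = 4*k+3" "2 * (2*k) + 2 = 4*k+2" "2 * (2*k) + 1 = 4*k+1" by simp_all
    have two: "2 * Suc k = Suc (Suc (2*k))" by simp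
    have 1: "qcen q (Suc (Suc (2*k))) * (1 - q^(4*k+4)) = qcen q (Suc (2*k)) * (1 - q^(4*k+3))"
      using qcen_Suc[OF q, of "Suc (2*k)"] unfolding ar .
    have 2: "qcen q (Suc (2*k)) * (1 - q^(4*k+2)) = qcen q (2*k) * (1 - q^(4*k+1))"
      using qcen_Suc[OF q, of "2*k"] unfolding ar .
    have "qcen q (2*Suc k) * ((1 - q^(4*k+2)) * (1 - q^(4*k+4))) = (qcen q (Suc (Suc (2*k))) * (1 - q^(4*k+4))) * (1 - q^(4*k+2))"
      unfolding two by (simp only: mult_ac)
    also have "\<dots> = (qcen q (Suc (2*k)) * (1 - q^(4*k+2))) * (1 - q^(4*k+3))"
      unfolding 1 by (simp only: mult_ac)
    also have "\<dots> = qcen q (2*k) * ((1 - q^(4*k+1)) * (1 - q^(4*k+3)))"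
      unfolding 2 by (simp only: mult_ac)
    finally show ?thesis .
  qed
  have "regular_term q a (Suc k) * (d0 * d1 * (1 - q^(4*k+2)) * (1 - q^(4*k+4)))
     = P * (w / (d0*d1)) * (q^(2*k^2) * q^(4*k+2)) * (d0*d1) * (qcen q (2*Suc k) * ((1 - q^(4*k+2)) * (1 - q^(4*k+4))))"
    unfolding regular_term_def e P_def[symmetric] d0_def[symmetric] d1_def[symmetric] w_def[symmetric] prod.lessThan_Suc by (simp only: mult_ac)
  also have "\<dots> = P * w * (q^(2*k^2) * q^(4*k+2)) * (qcen q (2*k) * ((1 - q^(4*k+1)) * (1 - q^(4*k+3))))"
    unfolding c using a unfolding d0_def[symmetric] d1_def[symmetric] by simp
  also have "\<dots> = regular_term q a k * (w * (1 - q^(4*k+1)) * (1 - q^(4*k+3)) * q^(4*k+2))"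
    unfolding regular_term_def P_def by (simp only: mult_ac)
  finally show ?thesis unfolding d0_def d1_def w_def .
qed

section \<open>Blocks of the sum at a root of unity of odd order\<close>

lemma half_block:
  assumes "odd (d::nat)" "d > 1" "\<not> 3 dvd d"
  defines "M \<equiv> (d - 1) div 2"
  shows "d = 2*M+1" "M < d" "M mod 3 \<noteq> 1"
proof -
  show 1: "d = 2*M+1" using assms(1) unfolding M_def by (auto elim!: oddE)
  then show "M < d" using assms(2) by simp
  \<comment> \<open>M congruent to 1 modulo 3 would make 2 * M + 1 divisible by 3.\<close>
  show "M mod 3 \<noteq> 1" using assms(3) unfolding 1 by presburger
qed

context
  fixes q :: "'a::field" and d M :: nat
  assumes d: "odd d" "d > 1" "\<not> 3 dvd d" and ord: "\<And>j. q^j = 1 \<longleftrightarrow> d dvd j" and neg: "\<And>j. q^Suc j \<noteq> -1"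
  defines "M \<equiv> (d - 1) div 2"
begin

text \<open>In the recurrence of \<open>qcen\<close> the factor 1 - q^(2m+1) vanishes at m = s*d+M,
  where 2m+1 = (2s+1)d. Up to the end of the block 1 - q^(2m+2) is nonzero, so the value stays
  0.\<close>

lemma qcen_root_eq_0:
  assumes "M < r" "r < d"
  shows "qcen q (s*d+r) = 0"
  using assms(2,1)
proof (induction r)
  case (Suc r)
  have r: "\<not> d dvd 2*(s*d+r)+2"
  proof
    assume "d dvd 2*(s*d+r)+2"
    also have "2*(s*d+r)+2 = 2*s*d + 2*(r+1)" by (simp add: algebra_simps)
    finally have "d dvd 2*(r+1)" using dvd_add_right_iff[of d "2*s*d" "2*(r+1)"] by simp
    then have "d dvd r+1" using d(1) coprime_dvd_mult_right_iff[of d 2 "r+1"] by simp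
    then show False using Suc.prems(1) by (auto dest: dvd_imp_le)
  qed
  have "qcen q (s*d+r) * (1 - q^(2*(s*d+r)+1)) = 0"
  proof (cases "M < r")
    case True
    then show ?thesis using Suc by simp
  next
    case False
    then have "r = M" using Suc.prems by simp
    then have "2*(s*d+r)+1 = (2*s+1)*d" using half_block(1)[OF d] unfolding M_def[symmetric] by (simp add: algebra_simps)
    then have "d dvd 2*(s*d+r)+1" by (metis dvd_triv_right)
    then have "q^(2*(s*d+r)+1) = 1" using ord by blast
    then show ?thesis by simp
  qed
  then have "qcen q (Suc (s*d+r)) * (1 - q^(2*(s*d+r)+2)) = 0" using qcen_Suc[OF neg, of "s*d+r"] by (simp only:)
  moreover have "1 - q^(2*(s*d+r)+2) \<noteq> 0" using r ord[of "2*(s*d+r)+2"] by simp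
  ultimately show ?case by simp
qed simp

text \<open>At k = k0 + i the power q^(2k) equals \<open>q^(2*i+e)\<close> because
  \<open>q^(s*d)\<close> is 1, so the block has the term ratio of \<open>vanishing_sum\<close> with
  b = q and parameter \<open>a*q\<close>.\<close>

lemma regular_term_block_sum:
  assumes a0: "a \<noteq> 0" and aq: "\<And>i j. a * q^i \<noteq> q^j" and se: "2 * k0 = s*d + e" "e \<le> 1" and K: "2*K + e \<le> d+1" "d \<le> 2*K+e"
  shows "(\<Sum>i<K. regular_term q a (k0+i) * (1 - q^(8*(k0+i)+1))) = 0"
proof -
  note M = half_block[OF d, folded M_def]
  have qd1: "q^d = 1" using ord by simp
  have q0: "q \<noteq> 0"
  proof
    assume "q = 0"
    then show False using qd1 d(2) by (simp add: power_0_left)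
  qed
  \<comment> \<open>The cutoff at M is needed since \<open>vanishing_sum\<close> wants zeros at all
    later indices, whereas \<open>regular_term\<close> may be nonzero again in the next
    block.\<close>
  define f where "f = (\<lambda>i. if 2*i+e \<le> M then regular_term q a (k0+i) else 0)"
  define c where "c = inverse (a*q)"
  have ac: "a*q*c = 1" using right_inverse[of "a*q"] a0 q0 unfolding c_def by simp
  have sum0: "(\<Sum>i<K. f i * (1 - q * (q^(2*i+e))^4)) = 0"
  proof (rule vanishing_sum[where a = "a*q" and c = c and d = d and M = M and f = f])
    show "a*q*c = 1" "q \<noteq> 0" "e \<le> 1" "1 < d" "M < d" "M mod 3 \<noteq> 1" by fact+
    show "a * q * q^i \<noteq> q^j" for i j using aq[of "Suc i" j] by (simp add: mult.assoc)
    show "(q^2)^j \<noteq> 1" if "0 < j" "j < d" for j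
    proof -
      have "\<not> d dvd j" using that by (auto dest: dvd_imp_le)
      then have "\<not> d dvd 2*j" using d(1) coprime_dvd_mult_right_iff[of d 2 j] by simp
      then show ?thesis using ord[of "2*j"] by (simp add: power_mult)
    qed
    have "q * q^(2*M) = q^d" by (subst M(1)) simp
    then show "q * q^(2*M) = 1" using ord[of d] by simp
    show "f k = 0" if "M < 2*k+e" for k using that by (simp add: f_def)
    show "M < 2*K+e" using M(2) K by simp
    fix k x
    assume x: "x = q^(2*k+e)"
    have x': "x = q^(2*(k0+k))"
    proof -
      have "2*(k0+k) = s*d + (2*k+e)" using se by simp
      then have "q^(2*(k0+k)) = q^(s*d) * q^(2*k+e)" by (simp only: power_add)
      moreover have "q^(s*d) = 1" using ord by simp
      ultimately show ?thesis using x by simp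
    qed
    define L where "L = (1 - q*(q^2)^3*x^3*c) * (1 - a*q*q*(q^2)^2*x^3) * (1 - q^2*x^2) * (1 - (q^2)^2*x^2)"
    define R where "R = (1 - a*q*x) * (1 - q^2*x*c) * (1 - q*x^2) * (1 - q*q^2*x^2) * (q^2*x^2)"
    have qx: "q^i*x^j = q^(i+2*(k0+k)*j)" for i j
      unfolding x' by (simp only: power_mult[symmetric] power_add[symmetric])
    have ee: "6*(k0+k)+6 = 6+2*(k0+k)*3" "4*(k0+k)+2 = 2+2*(k0+k)*2" "4*(k0+k)+4 = 4+2*(k0+k)*2"
       "2*(k0+k)+1 = 1+2*(k0+k)*1" "4*(k0+k)+1 = 1+2*(k0+k)*2" "4*(k0+k)+3 = 3+2*(k0+k)*2"
      by simp_all
    have xx: "q^(6*(k0+k)+6) = q^6*x^3" "q^(4*(k0+k)+2) = q^2*x^2" "q^(4*(k0+k)+4) = q^4*x^2" "q^(2*(k0+k)+1) = q*x"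
       "q^(4*(k0+k)+1) = q*x^2" "q^(4*(k0+k)+3) = q^3*x^2"
      unfolding ee qx[symmetric] by simp_all
    have L: "L = (1 - a*q^(6*(k0+k)+6)) * (a - q^(6*(k0+k)+6)) * (1 - q^(4*(k0+k)+2)) * (1 - q^(4*(k0+k)+4)) / a"
    proof -
      have "a*(q*(q^2)^3*x^3*c) = (a*q*c)*(q^6*x^3)" by (simp add: mult_ac flip: power_mult)
      then have "a*(1 - q*(q^2)^3*x^3*c) = a - q^6*x^3" unfolding ac by (simp add: right_diff_distrib)
      then have 1: "1 - q*(q^2)^3*x^3*c = (a - q^6*x^3) / a" using a0 by (simp add: eq_divide_eq mult.commute)
      have 2: "1 - a*q*q*(q^2)^2*x^3 = 1 - a*(q^6*x^3)" by (simp add: power_numeral_reduce mult_ac)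
      have 3: "1 - (q^2)^2*x^2 = 1 - q^4*x^2" by (simp flip: power_mult)
      show ?thesis unfolding L_def xx 1 2 3 by simp
    qed
    have R: "R = (1 - a*q^(2*(k0+k)+1)) * (a - q^(2*(k0+k)+1)) * (1 - q^(4*(k0+k)+1)) * (1 - q^(4*(k0+k)+3)) * q^(4*(k0+k)+2) / a"
    proof -
      have "a*(q^2*x*c) = (a*q*c)*(q*x)" by (simp add: mult_ac power2_eq_square)
      then have "a*(1 - q^2*x*c) = a - q*x" unfolding ac by (simp add: right_diff_distrib)
      then have 1: "1 - q^2*x*c = (a - q*x) / a" using a0 by (simp add: eq_divide_eq mult.commute)
      have 2: "1 - a*q*x = 1 - a*(q*x)" by (simp add: mult_ac)
      have 3: "1 - q*q^2*x^2 = 1 - q^3*x^2" by (simp add: power_numeral_reduce)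
      show ?thesis unfolding R_def xx 1 2 3 by simp
    qed
    have T: "regular_term q a (Suc (k0+k)) * L = regular_term q a (k0+k) * R"
    proof -
      have "1 - a * q^(6*(k0+k)+6) \<noteq> 0" using aq[of "6*(k0+k)+6" 0] by simp
      moreover have "a - q^(6*(k0+k)+6) \<noteq> 0" using aq[of 0 "6*(k0+k)+6"] by simp
      ultimately show ?thesis unfolding L R using regular_term_Suc[OF neg, of a "k0+k"] by simp
    qed
    have "f (Suc k) * L = f k * R"
    proof (cases "2*Suc k+e \<le> M")
      case True
      then show ?thesis using T by (simp add: f_def)
    next
      case False
      \<comment> \<open>At the last kept index \<open>2*k+e\<close> is M or M - 1, and there
        \<open>1 - q*x^2\<close> or \<open>1 - q*q^2*x^2\<close> is 0: the recurrence respects the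
        cutoff.\<close>
      have "f k * R = 0"
      proof (cases "2*k+e \<le> M")
        case True
        have qd: "q * q^(2*M) = 1" by fact
        from False True have "2*k+e = M \<or> 2*k+e+1 = M" by arith
        then consider "2*k+e = M" | "2*k+e+1 = M" by blast
        then show ?thesis
        proof cases
          case 1
          have "x^2 = q^(2*M)" unfolding x 1 power_mult[symmetric] by (simp add: mult.commute)
          then show ?thesis using qd by (simp add: R_def)
        next
          case 2
          have "2 + (2*k+e)*2 = 2*M" using 2 by simp
          then have "q^2*x^2 = q^(2*M)" unfolding x power_mult[symmetric] power_add[symmetric] by (simp only:)
          then show ?thesis using qd by (simp add: R_def mult.assoc)
        qed
      qed (simp add: f_def)
      then show ?thesis using False by (simp add: f_def)
    qed
    then show "f (Suc k) * ((1 - q*(q^2)^3*x^3*c) * (1 - a*q*q*(q^2)^2*x^3) * (1 - q^2*x^2) * (1 - (q^2)^2*x^2))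
      = f k * ((1 - a*q*x) * (1 - q^2*x*c) * (1 - q*x^2) * (1 - q*q^2*x^2) * (q^2*x^2))"
      unfolding L_def R_def .
  qed
  have "regular_term q a (k0+i) * (1 - q^(8*(k0+i)+1)) = f i * (1 - q * (q^(2*i+e))^4)" if "i < K" for i
  proof -
    have "8*k0 = 4*s*d + 4*e" using arg_cong[OF se(1), of "(*) 4"] by (simp add: algebra_simps)
    then have "8*(k0+i)+1 = 1 + (4*s*d + (2*i+e)*4)" by simp
    then have "q^(8*(k0+i)+1) = q * (q^(4*s*d) * (q^(2*i+e))^4)" 
      by (simp only: power_add[of q 1] power_add[of q "4*s*d"] power_mult[of q "2*i+e" 4] power_one_right)
    moreover have "q^(4*s*d) = 1" using ord by simp
    \<comment> \<open>Inside the block the terms beyond M are 0 by \<open>qcen_root_eq_0\<close>, so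
      the cutoff changes nothing.\<close>
    moreover have "regular_term q a (k0+i) = f i"
    proof (cases "2*i+e \<le> M")
      case False
      have "2*(k0+i) = s*d + (2*i+e)" using se by simp
      then have "qcen q (2*(k0+i)) = qcen q (s*d+(2*i+e))" by (simp only:)
      also have "\<dots> = 0" using False that K by (intro qcen_root_eq_0) auto
      finally have "regular_term q a (k0+i) = 0" unfolding regular_term_def by simp
      then show ?thesis using False by (simp add: f_def)
    qed (simp add: f_def)
    ultimately show ?thesis by simp
  qed
  then show ?thesis using sum0 by simp
qed

text \<open>Block s starts at the ceiling of s*d/2, written \<open>(s*d+1) div 2\<close>, and
  induction on s adds one vanishing block at a time. For n = d * t the whole range is reached at s =
  2 * t.\<close>

lemma regular_term_root_sum:
  assumes a0: "a \<noteq> 0" and aq: "\<And>i j. a * q^i \<noteq> q^j" and n: "d dvd n"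
  shows "(\<Sum>k<n. regular_term q a k * (1 - q^(8*k+1))) = 0"
proof -
  have *: "(\<Sum>k<(s*d+1) div 2. regular_term q a k * (1 - q^(8*k+1))) = 0" for s
  proof (induction s)
    case (Suc s)
    define y where "y = s*d"
    \<comment> \<open>Relative to y / 2 the index k0 + i is i + e / 2, so an odd y gives the
      half-integer case.\<close>
    define k0 e K where "k0 = (y+1) div 2" and "e = y mod 2" and "K = (d+y+1) div 2 - k0"
    have se: "2*k0 = y+e" "e \<le> 1" unfolding k0_def e_def by presburger+
    have "k0 \<le> (d+y+1) div 2" unfolding k0_def by (rule div_le_mono) simp
    then have le: "k0 + K = (d+y+1) div 2" unfolding K_def by simp
    have "2*(x div 2) \<le> x" "x \<le> 2*(x div 2) + 1" for x :: nat by presburger+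
    from this[of "d+y+1"] have K: "2*K+e \<le> d+1" "d \<le> 2*K+e" unfolding le[symmetric] using se by simp_all
    have y: "Suc s*d+1 = d+y+1" by (simp add: y_def)
    have "(\<Sum>k<k0+K. g k) = (\<Sum>k<k0. g k) + (\<Sum>i<K. g (k0+i))" for g :: "nat \<Rightarrow> 'a"
      by (induction K) (simp_all add: add.assoc)
    moreover have "(\<Sum>k<k0. regular_term q a k * (1 - q^(8*k+1))) = 0" using Suc unfolding k0_def y_def .
    moreover have "(\<Sum>i<K. regular_term q a (k0+i) * (1 - q^(8*(k0+i)+1))) = 0" by (rule regular_term_block_sum[OF a0 aq se[unfolded y_def] K])
    ultimately show ?case unfolding y le[symmetric] by simp
  qed simp
  from n obtain t where "n = d*t" by blast
  then have "n = (2*t*d+1) div 2" by simp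
  then show ?thesis using *[of "2*t"] by simp
qed

end

section \<open>Evaluation and coprimality in Z[q][a]\<close>

text \<open>Instances are the evaluations at complex points and the embedding into the fraction
  field; ring expressions commute with both.\<close>

locale ring_hom_fun =
  fixes h :: "'a::comm_ring_1 \<Rightarrow> 'b::comm_ring_1"
  assumes hom_1: "h 1 = 1" and hom_add: "h (x + y) = h x + h y" and hom_mult: "h (x * y) = h x * h y"
begin

lemma hom_0: "h 0 = 0" using hom_add[of 0 0] by simp
lemma hom_uminus: "h (- x) = - h x" using hom_add[of x "- x"] by (simp add: hom_0 eq_neg_iff_add_eq_0 add.commute)
lemma hom_diff: "h (x - y) = h x - h y" using hom_add[of x "- y"] by (simp add: hom_uminus)
lemma hom_power: "h (x ^ n) = h x ^ n" by (induction n) (simp_all add: hom_1 hom_mult)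
lemma hom_sum: "h (\<Sum>x\<in>A. f x) = (\<Sum>x\<in>A. h (f x))"
  by (induction A rule: infinite_finite_induct) (simp_all add: hom_0 hom_add)
lemma hom_prod: "h (\<Prod>x\<in>A. f x) = (\<Prod>x\<in>A. h (f x))"
  by (induction A rule: infinite_finite_induct) (simp_all add: hom_1 hom_mult)
lemma hom_of_nat: "h (of_nat n) = of_nat n"
  by (induction n) (simp_all add: hom_0 hom_1 hom_add)
lemma hom_of_int: "h (of_int n) = of_int n"
  by (cases n rule: int_cases2) (simp_all add: hom_of_nat hom_uminus)

lemma map_poly_mult: "map_poly h (p * q) = map_poly h p * map_poly h q"
  by (rule poly_eqI) (simp add: coeff_map_poly hom_0 coeff_mult hom_sum hom_mult)
lemma map_poly_add: "map_poly h (p + q) = map_poly h p + map_poly h q"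
  by (rule poly_eqI) (simp add: coeff_map_poly hom_0 hom_add)

lemma ring_hom_poly: "ring_hom_fun (\<lambda>p. poly (map_poly h p) x)"
  by unfold_locales (simp_all add: map_poly_mult map_poly_add hom_1 hom_0 map_poly_pCons one_pCons)

lemmas hom_simps = hom_0 hom_1 hom_add hom_mult hom_diff hom_uminus hom_power hom_sum hom_prod hom_of_int

end

lemma ring_hom_of_int: "ring_hom_fun of_int" by unfold_locales simp_all
lemma ring_hom_to_fract: "ring_hom_fun to_fract" by unfold_locales simp_all

definition ev :: "complex \<Rightarrow> int poly \<Rightarrow> complex" where
  "ev z p = poly (map_poly of_int p) z"

text \<open>The outer variable of \<open>int poly poly\<close> is a, with value \<alpha>; the inner
  one is q, with value z.\<close>

definition ev2 :: "complex \<Rightarrow> complex \<Rightarrow> int poly poly \<Rightarrow> complex" where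
  "ev2 z \<alpha> P = poly (map_poly (ev z) P) \<alpha>"

lemma ring_hom_ev: "ring_hom_fun (ev z)"
  using ring_hom_fun.ring_hom_poly[OF ring_hom_of_int] unfolding ev_def[abs_def] .
lemma ring_hom_ev2: "ring_hom_fun (ev2 z \<alpha>)"
  using ring_hom_fun.ring_hom_poly[OF ring_hom_ev] unfolding ev2_def[abs_def] .

interpretation ev: ring_hom_fun "ev z" for z by (rule ring_hom_ev)
interpretation ev2: ring_hom_fun "ev2 z \<alpha>" for z \<alpha> by (rule ring_hom_ev2)

lemma ev_X: "ev z [:0, 1:] = z" by (simp add: ev_def map_poly_pCons)
lemma ev2_pCons: "ev2 z \<alpha> (pCons c P) = ev z c + \<alpha> * ev2 z \<alpha> P"
  by (simp add: ev2_def map_poly_pCons ev.hom_0)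
lemma ev2_0: "ev2 z \<alpha> 0 = 0" by (rule ev2.hom_0)

text \<open>An infinite set of test points: such a q is no root of unity, and such an a is never a
  quotient of powers of a root of unity.\<close>

lemma infinite_norm_gt_1: "infinite {z::complex. norm z > 1}"
proof -
  have "inj (\<lambda>n. of_nat (n + 2) :: complex)" by (auto simp: inj_on_def)
  then have "infinite (range (\<lambda>n. of_nat (n + 2) :: complex))" by (rule range_inj_infinite)
  moreover have "norm (of_nat (n + 2) :: complex) > 1" for n unfolding norm_of_nat by simp
  then have "range (\<lambda>n. of_nat (n + 2) :: complex) \<subseteq> {z. norm z > 1}" by blast
  ultimately show ?thesis using finite_subset by blast
qed

lemma poly_zero_outside_disc:
  fixes p :: "complex poly"
  assumes "\<And>z. norm z > 1 \<Longrightarrow> poly p z = 0"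
  shows "p = 0"
proof (rule ccontr)
  assume "p \<noteq> 0"
  then have "finite {z. poly p z = 0}" by (rule poly_roots_finite)
  then show False using infinite_norm_gt_1 assms by (metis (mono_tags, lifting) finite_subset mem_Collect_eq subsetI)
qed

lemma ev_zero_outside_disc:
  assumes "\<And>z. norm z > 1 \<Longrightarrow> ev z c = 0"
  shows "c = 0"
proof -
  have "map_poly of_int c = (0 :: complex poly)"
    by (rule poly_zero_outside_disc) (use assms in \<open>simp add: ev_def\<close>)
  then show ?thesis by (simp add: map_poly_eq_0_iff)
qed

section \<open>Divisibility by [n] and by the linear factors\<close>

definition qgeom :: "'a::comm_ring_1 \<Rightarrow> nat \<Rightarrow> 'a" where
  "qgeom q n = (\<Sum>i<n. q ^ i)"

lemma qgeom_mult: "(1 - q) * qgeom q n = 1 - q ^ n"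
  unfolding qgeom_def using one_diff_power_eq by metis

lemma qgeom_eq_qint: "q \<noteq> 1 \<Longrightarrow> qgeom q n = qint q n"
  using qgeom_mult[of q n] by (simp add: qint_def field_simps)

lemma coeff_qgeom_X: "Polynomial.coeff (qgeom [:0, 1:] n) i = (if i < n then 1 else 0 :: int)"
proof -
  have "qgeom [:0, 1::int:] n = (\<Sum>i<n. Polynomial.monom 1 i)"
    unfolding qgeom_def by (simp add: monom_altdef)
  then show ?thesis by (simp add: coeff_sum)
qed

lemma degree_qgeom_X: "Polynomial.degree (qgeom [:0, 1::int:] n) = n - 1"
proof (rule antisym)
  show "Polynomial.degree (qgeom [:0, 1::int:] n) \<le> n - 1" by (rule degree_le) (auto simp: coeff_qgeom_X)
  show "n - 1 \<le> Polynomial.degree (qgeom [:0, 1::int:] n)" by (cases "n = 0") (auto intro!: le_degree simp: coeff_qgeom_X)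
qed

lemma qgeom_X_neq_0: "n > 0 \<Longrightarrow> qgeom [:0, 1::int:] n \<noteq> 0"
  using coeff_qgeom_X[of n 0] by auto

text \<open>[n] is monic of degree n - 1, so the pseudo-remainder is a true remainder over the
  integers. It vanishes at the n - 1 nontrivial n-th roots of unity, too many for its
  degree.\<close>

lemma qgeom_dvd:
  assumes n: "n > 0" and z: "\<And>z. z ^ n = 1 \<Longrightarrow> z \<noteq> 1 \<Longrightarrow> ev z c = 0"
  shows "qgeom [:0, 1:] n dvd c"
proof -
  define g where "g = qgeom [:0, 1::int:] n"
  obtain s r where sr: "pseudo_divmod c g = (s, r)" by fastforce
  have g0: "g \<noteq> 0" using qgeom_X_neq_0[OF n] by (simp add: g_def)
  have "Polynomial.coeff g (Polynomial.degree g) = 1" using n by (simp add: g_def degree_qgeom_X coeff_qgeom_X)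
  then have c: "c = g * s + r" using pseudo_divmod(1)[OF g0 sr] by simp
  have rd: "r = 0 \<or> Polynomial.degree r < n - 1" using pseudo_divmod(2)[OF g0 sr] by (simp add: g_def degree_qgeom_X)
  have "r = 0"
  proof (rule ccontr)
    assume r0: "r \<noteq> 0"
    define R where "R = (map_poly of_int r :: complex poly)"
    have R0: "R \<noteq> 0" using r0 by (simp add: R_def map_poly_eq_0_iff)
    have "poly R z = 0" if "z ^ n = 1" "z \<noteq> 1" for z
    proof -
      have "ev z g = qgeom z n" unfolding g_def qgeom_def by (simp add: ev.hom_simps ev_X)
      moreover have "(1 - z) * qgeom z n = 0" unfolding qgeom_mult using that by simp
      ultimately have "ev z g = 0" using that by simp
      then have "ev z r = 0" using z[OF that] unfolding c by (simp add: ev.hom_simps)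
      then show ?thesis by (simp add: R_def ev_def)
    qed
    then have "{z. z ^ n = 1} - {1} \<subseteq> {z. poly R z = 0}" by auto
    then have "card ({z::complex. z ^ n = 1} - {1}) \<le> card {z. poly R z = 0}"
      by (intro card_mono poly_roots_finite R0)
    also have "\<dots> \<le> Polynomial.degree R" by (rule card_poly_roots_bound) fact
    also have "\<dots> \<le> Polynomial.degree r" unfolding R_def by (rule map_poly_degree_leq)
    finally have "n - 1 \<le> Polynomial.degree r" using card_roots_unity_eq[OF n] by (simp add: card_Diff_singleton)
    then show False using rd r0 by simp
  qed
  then show ?thesis using c by (simp add: g_def)
qed

lemma qgeom_const: "qgeom [:q:] n = [:qgeom q n:]"
proof -
  have "(\<Sum>i<n. [:q:] ^ i) = [:\<Sum>i<n. q ^ i:]"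
    by (induction n) (simp_all add: poly_const_pow)
  then show ?thesis by (simp add: qgeom_def)
qed

text \<open>For fixed z the polynomial in a has infinitely many zeros, so all its coefficients
  vanish at z and \<open>qgeom_dvd\<close> applies to each.\<close>

lemma qgeom_dvd_poly:
  assumes n: "n > 0" and z: "\<And>z \<alpha>. z ^ n = 1 \<Longrightarrow> z \<noteq> 1 \<Longrightarrow> norm \<alpha> > 1 \<Longrightarrow> ev2 z \<alpha> P = 0"
  shows "qgeom [:[:0, 1:]:] n dvd P"
  unfolding qgeom_const const_poly_dvd_iff
proof (intro allI qgeom_dvd n)
  fix i z
  assume "z ^ n = 1" "(z::complex) \<noteq> 1"
  then have "map_poly (ev z) P = 0"
    using z unfolding ev2_def by (intro poly_zero_outside_disc) auto
  then have "Polynomial.coeff (map_poly (ev z) P) i = 0" by simp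
  then show "ev z (Polynomial.coeff P i) = 0" by (simp add: coeff_map_poly ev.hom_0)
qed

text \<open>The divisor is monic in a, so it suffices that substituting q^n for a gives 0; the
  result is a polynomial in q with infinitely many zeros.\<close>

lemma linear_dvd_poly:
  assumes "\<And>z. norm z > 1 \<Longrightarrow> ev2 z (z ^ n) P = 0"
  shows "[:- ([:0, 1:] ^ n), 1:] dvd P"
proof -
  have e: "ev2 z (ev z c) Q = ev z (poly Q c)" for z c Q
    by (induction Q) (simp_all add: ev2_pCons ev2_0 ev.hom_simps)
  have "poly P ([:0, 1:] ^ n) = 0"
  proof (rule ev_zero_outside_disc)
    fix z :: complex assume "norm z > 1"
    then show "ev z (poly P ([:0, 1:] ^ n)) = 0" 
      unfolding e[symmetric] using assms by (simp add: ev.hom_simps ev_X)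
  qed
  then show ?thesis by (simp add: poly_eq_0_iff_dvd)
qed

text \<open>The divisor 1 - c a is not monic in a, so a power of c is multiplied in. The induction
  uses that c a r leaves the remainder r.\<close>

lemma pseudo_remainder_linear:
  fixes c :: "'a::comm_ring_1"
  shows "\<exists>D S r. [:c ^ D:] * P = [:1, -c:] * S + [:r:]"
proof (induction P)
  case 0
  have "[:c ^ 0:] * 0 = [:1, -c:] * 0 + [:0:]" by simp
  then show ?case by blast
next
  case (pCons u P)
  then obtain D S r where IH: "[:c ^ D:] * P = [:1, -c:] * S + [:r:]" by blast
  have "[:c ^ Suc D:] * pCons u P = [:c ^ Suc D * u:] + [:0, c:] * ([:c ^ D:] * P)"
    by (simp add: algebra_simps)
  also have "\<dots> = [:1, -c:] * ([:0, c:] * S - [:r:]) + [:c ^ Suc D * u + r:]"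
    unfolding IH by (simp add: algebra_simps smult_add_right)
  finally show ?case by blast
qed

text \<open>The remainder is free of a and vanishes at all test points, hence is 0; the power of c
  is removed because c is coprime to 1 - c a.\<close>

lemma linear_dvd_poly':
  assumes n: "n > 0" and z: "\<And>z. norm z > 1 \<Longrightarrow> ev2 z (1 / z ^ n) P = 0"
  shows "[:1, - ([:0, 1:] ^ n):] dvd P"
proof -
  define c where "c = [:0, 1::int:] ^ n"
  obtain D S r where D: "[:c ^ D:] * P = [:1, -c:] * S + [:r:]" using pseudo_remainder_linear by blast
  have "r = 0"
  proof (rule ev_zero_outside_disc)
    fix z :: complex assume z1: "norm z > 1"
    have "ev2 z (1 / z ^ n) [:1, -c:] = 0"
      using z1 by (auto simp: ev2_pCons ev2_0 ev.hom_simps c_def ev_X)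
    moreover have "ev2 z (1 / z ^ n) ([:c ^ D:] * P) = ev2 z (1 / z ^ n) ([:1, -c:] * S + [:r:])" by (simp only: D)
    ultimately have "ev2 z (1 / z ^ n) [:r:] = 0" using z[OF z1] by (simp only: ev2.hom_simps) simp
    then show "ev z r = 0" by (simp add: ev2_pCons ev2_0)
  qed
  have "[:1, -c:] dvd [:c ^ D:] * P" unfolding D \<open>r = 0\<close> pCons_0_0 add_0_right by (intro dvd_triv_left)
  moreover have "coprime [:1, -c:] [:c ^ D:]"
  proof -
    have "coprime [:1, -c:] [:c:]"
    proof (rule coprimeI)
      fix d assume "d dvd [:1, -c:]" "d dvd [:c:]"
      then have "d dvd [:1, -c:] + [:c:] * [:0, 1:]" by (intro dvd_add dvd_mult2)
      then show "is_unit d" by (simp add: one_pCons)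
    qed
    moreover have "[:c ^ D:] = [:c:] ^ D" by (simp add: poly_const_pow)
    ultimately show ?thesis by simp
  qed
  ultimately show ?thesis unfolding c_def[symmetric] using coprime_dvd_mult_right_iff by blast
qed

section \<open>Coprimality in Z[q][a]\<close>

lemma unit_if_dvd_const_linear:
  fixes h :: "int poly poly"
  assumes "h dvd [:g:]" "g \<noteq> 0" "h dvd [:\<alpha>, \<beta>:]" "coprime \<alpha> \<beta>"
  shows "is_unit h"
proof -
  \<comment> \<open>A divisor of a nonzero polynomial in q alone has degree 0 in a, and so it
    divides both coefficients of the linear polynomial.\<close>
  have "Polynomial.degree h = 0" using dvd_imp_degree_le[OF assms(1)] assms(2) by simp
  then obtain c where c: "h = [:c:]" by (rule degree_eq_zeroE)
  have "c dvd Polynomial.coeff [:\<alpha>, \<beta>:] i" for i using assms(3) unfolding c const_poly_dvd_iff by blast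
  from this[of 0] this[of 1] have "c dvd \<alpha>" "c dvd \<beta>" by simp_all
  then have "is_unit c" using assms(4) coprime_common_divisor by blast
  then show ?thesis unfolding c by (simp add: is_unit_const_poly_iff)
qed

lemma coprime_const_linear:
  fixes g \<alpha> \<beta> :: "int poly"
  shows "g \<noteq> 0 \<Longrightarrow> coprime \<alpha> \<beta> \<Longrightarrow> coprime [:g:] [:\<alpha>, \<beta>:]"
  by (rule coprimeI) (rule unit_if_dvd_const_linear)

text \<open>Eliminating a leaves the determinant
  \<open>\<alpha> * \<delta> - \<beta> * \<gamma>\<close>, a nonzero polynomial in q.\<close>

lemma coprime_linear_linear:
  fixes \<alpha> \<beta> \<gamma> \<delta> :: "int poly"
  assumes "coprime \<alpha> \<beta>" "\<alpha> * \<delta> \<noteq> \<beta> * \<gamma>"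
  shows "coprime [:\<alpha>, \<beta>:] [:\<gamma>, \<delta>:]"
proof (rule coprimeI)
  fix h assume h: "h dvd [:\<alpha>, \<beta>:]" "h dvd [:\<gamma>, \<delta>:]"
  then have "h dvd [:\<delta>:] * [:\<alpha>, \<beta>:] - [:\<beta>:] * [:\<gamma>, \<delta>:]" by (intro dvd_diff dvd_mult)
  also have "\<dots> = [:\<alpha> * \<delta> - \<beta> * \<gamma>:]" by (simp add: mult.commute)
  finally show "is_unit h" by (rule unit_if_dvd_const_linear[OF _ _ h(1) assms(1)]) (use assms(2) in simp)
qed

lemma coprime_const_const:
  fixes g c :: "int poly"
  assumes "g \<noteq> 0" "coprime g c"
  shows "coprime [:g:] [:c:]"
proof (intro coprimeI)
  fix h assume h: "h dvd [:g:]" "h dvd [:c:]"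
  have "Polynomial.degree h = 0" using dvd_imp_degree_le[OF h(1)] assms(1) by simp
  then obtain d where d: "h = [:d:]" by (rule degree_eq_zeroE)
  have "d dvd g" "d dvd c" using h unfolding d by simp_all
  then have "is_unit d" using assms(2) coprime_common_divisor by blast
  then show "is_unit h" unfolding d by (simp add: is_unit_const_poly_iff)
qed

lemma coprime_qgeom_X:
  assumes "n > 0"
  shows "coprime (qgeom [:0, 1::int:] n) [:0, 1:]"
proof (rule coprimeI)
  fix d assume d: "d dvd qgeom [:0, 1::int:] n" "d dvd [:0, 1:]"
  obtain m where n: "n = Suc m" using assms gr0_implies_Suc by blast
  have "qgeom [:0, 1::int:] n = 1 + [:0, 1:] * qgeom [:0, 1:] m"
    unfolding qgeom_def n sum.lessThan_Suc_shift by (simp add: sum_distrib_left del: pCons_one)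
  then have "1 = qgeom [:0, 1::int:] n - [:0, 1:] * qgeom [:0, 1:] m" by simp
  then show "is_unit d" using d by (metis dvd_diff dvd_mult2)
qed

text \<open>With y = q^(j+1), a common divisor divides 1 - y^n by way of [n], and 1 + y^n since y is
  congruent to -1 and n is odd. So it divides 2, is an integer, and divides the constant term 1 of
  [n].\<close>

lemma coprime_qgeom_X_plus_1:
  assumes "odd n"
  shows "coprime (qgeom [:0, 1::int:] n) (1 + [:0, 1:] ^ Suc j)"
proof (rule coprimeI)
  define X where "X = [:0, 1::int:]"
  have n: "n > 0" using assms by (cases n) auto
  fix d assume d: "d dvd qgeom [:0, 1::int:] n" "d dvd 1 + [:0, 1:] ^ Suc j"
  define y where "y = X ^ Suc j"
  have "d dvd 1 - X ^ n" using d(1) unfolding qgeom_mult[symmetric] X_def by (rule dvd_mult)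
  also have "1 - X ^ n dvd 1 - (X ^ n) ^ Suc j" unfolding qgeom_mult[symmetric, of "X ^ n"] by (rule dvd_triv_left)
  also have "(X ^ n) ^ Suc j = y ^ n" unfolding y_def by (simp only: power_mult[symmetric] mult.commute)
  finally have 1: "d dvd 1 - y ^ n" .
  have "d dvd 1 - (- y)" using d(2) unfolding y_def X_def diff_minus_eq_add .
  also have "1 - (- y) dvd 1 - (- y) ^ n" unfolding qgeom_mult[symmetric, of "- y"] by (rule dvd_triv_left)
  also have "(- y) ^ n = - (y ^ n)" using assms by simp
  finally have "d dvd (1 - y ^ n) + (1 - - (y ^ n))" using 1 by (intro dvd_add)
  then have d2: "d dvd [:2:]" by (simp add: numeral_poly)
  then have "Polynomial.degree d = 0" using dvd_imp_degree_le[OF d2] by simp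
  then obtain c where c: "d = [:c:]" by (rule degree_eq_zeroE)
  have "c dvd Polynomial.coeff (qgeom [:0, 1::int:] n) 0" using d(1) unfolding c const_poly_dvd_iff by blast
  then have "is_unit c" using n by (simp add: coeff_qgeom_X)
  then show "is_unit d" unfolding c by (simp add: is_unit_const_poly_iff)
qed

section \<open>Numerator and denominator of the difference\<close>

lemma qpoch_ratio_eq_qcen:
  fixes q :: "'a::field"
  assumes q1: "\<And>j. j > 0 \<Longrightarrow> q^j \<noteq> 1" and neg: "\<And>j. q ^ Suc j \<noteq> -1"
  shows "qpoch q (q^2) m / qpoch (q^2) (q^2) m = qcen q m"
proof (induction m)
  case 0
  show ?case by (simp add: qcen_def)
next
  case (Suc m)
  have nz: "1 - q^(2*m+2) \<noteq> 0" using q1[of "2*m+2"] by simp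
  have "qpoch q (q^2) (Suc m) / qpoch (q^2) (q^2) (Suc m) = qcen q m * ((1 - q^(2*m+1)) / (1 - q^(2*m+2)))"
    unfolding qpoch_Suc Suc[symmetric] power_mult[symmetric] power_add[symmetric] power_Suc[symmetric]
    by (simp add: add.commute)
  also have "\<dots> = qcen q (Suc m)" using qcen_Suc[OF neg, of m] nz by (simp add: field_simps)
  finally show ?case .
qed

lemma regular_term_eq:
  fixes q a :: "'a::field"
  assumes q1: "\<And>j. j > 0 \<Longrightarrow> q^j \<noteq> 1" and neg: "\<And>j. q ^ Suc j \<noteq> -1" and a: "a \<noteq> 0"
  shows "(qpoch (a * q) (q ^ 2) k * qpoch (q / a) (q ^ 2) k * qpoch q (q ^ 2) (2 * k)) /
        (qpoch (q ^ 2) (q ^ 2) (2 * k) * qpoch (a * q ^ 6) (q ^ 6) k * qpoch (q ^ 6 / a) (q ^ 6) k) * q ^ (2 * k ^ 2)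
     = regular_term q a k"
proof -
  have "regular_term q a k = (qpoch (a * q) (q ^ 2) k * qpoch (q / a) (q ^ 2) k) / (qpoch (a * q ^ 6) (q ^ 6) k * qpoch (q ^ 6 / a) (q ^ 6) k)
      * qcen q (2*k) * q ^ (2 * k ^ 2)"
  proof -
    have "(\<Prod>j<k. (1 - a * q^(2*j+1)) * (a - q^(2*j+1)) / ((1 - a * q^(6*j+6)) * (a - q^(6*j+6))))
      = (\<Prod>j<k. ((1 - a * q * (q^2)^j) * (1 - q / a * (q^2)^j)) / ((1 - a * q^6 * (q^6)^j) * (1 - q^6 / a * (q^6)^j)))"
    proof (rule prod.cong)
      fix j
      have 1: "a - q^(2*j+1) = a * (1 - q / a * (q^2)^j)" "a - q^(6*j+6) = a * (1 - q^6 / a * (q^6)^j)"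
          "1 - a * q^(2*j+1) = 1 - a * q * (q^2)^j" "1 - a * q^(6*j+6) = 1 - a * q^6 * (q^6)^j"
        unfolding power_mult[symmetric] using a by (simp_all add: right_diff_distrib power_add mult_ac)
      show "(1 - a * q^(2*j+1)) * (a - q^(2*j+1)) / ((1 - a * q^(6*j+6)) * (a - q^(6*j+6)))
         = ((1 - a * q * (q^2)^j) * (1 - q / a * (q^2)^j)) / ((1 - a * q^6 * (q^6)^j) * (1 - q^6 / a * (q^6)^j))"
        unfolding 1 using a by simp
    qed simp
    then show ?thesis by (simp add: regular_term_def qpoch_def prod_dividef prod.distrib)
  qed
  moreover have "X * Y * C / (E * U * V) * w = X * Y / (U * V) * (C / E) * w" for X Y C E U V w :: 'a by simp
  ultimately show ?thesis by (simp only: qpoch_ratio_eq_qcen[OF q1 neg])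
qed

text \<open>The k-th summand times \<open>common_den\<close>: the products from k to n and from 2k
  to 2n are the denominator factors missing in the summand. Only ring operations occur, so one
  formula serves Z[q][a], its fraction field and the complex numbers.\<close>

definition term_num :: "'a::comm_ring_1 \<Rightarrow> 'a \<Rightarrow> nat \<Rightarrow> nat \<Rightarrow> 'a" where
  "term_num q a n k = (\<Prod>j<k. (1 - a * q^(2*j+1)) * (a - q^(2*j+1))) * (\<Prod>j\<in>{k..<n}. (1 - a * q^(6*j+6)) * (a - q^(6*j+6)))
     * qbin q (2*(2*k)) (2*k) * (\<Prod>j\<in>{2*k..<2*n}. (1 + q ^ Suc j)^2) * qgeom q (8*k+1) * q^(2*k^2)"

definition common_den :: "'a::comm_ring_1 \<Rightarrow> 'a \<Rightarrow> nat \<Rightarrow> 'a" where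
  "common_den q a n = (\<Prod>j<n. (1 - a * q^(6*j+6)) * (a - q^(6*j+6))) * (\<Prod>j<2*n. (1 + q ^ Suc j)^2)"

text \<open>The numerator of the difference of the two sides over
  \<open>common_den q a n * q^((n-1) div 2)\<close>; the power of q clears the negative exponent on
  the right.\<close>

definition diff_num :: "'a::comm_ring_1 \<Rightarrow> 'a \<Rightarrow> nat \<Rightarrow> 'a" where
  "diff_num q a n = (\<Sum>k<n. term_num q a n k) * q^((n-1) div 2) - of_int (sgn3 n) * qgeom q n * common_den q a n"

lemma term_num_eq:
  fixes q a :: "'a::field"
  assumes neg: "\<And>j. q ^ Suc j \<noteq> -1" and nz: "\<And>j. (1 - a * q^(6*j+6)) * (a - q^(6*j+6)) \<noteq> 0" and k: "k \<le> n"
  shows "term_num q a n k = regular_term q a k * qgeom q (8*k+1) * common_den q a n"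
proof -
  have split: "(\<Prod>j<m. f j) = (\<Prod>j<l. f j) * (\<Prod>j\<in>{l..<m}. f j)" if "l \<le> m" for f :: "nat \<Rightarrow> 'a" and l m
    using that by (simp add: prod.atLeastLessThan_concat lessThan_atLeast0)
  define A B where "A = (\<Prod>j<k. (1 - a * q^(6*j+6)) * (a - q^(6*j+6)))" and "B = (\<Prod>j<2*k. (1 + q ^ Suc j)^2)"
  have n1: "1 + q ^ Suc j \<noteq> 0" for j using neg[of j] by (metis add.commute add_eq_0_iff)
  have AB: "A \<noteq> 0" "B \<noteq> 0" unfolding A_def B_def using nz n1 by (simp_all del: power_Suc)
  have D: "common_den q a n = A * (\<Prod>j\<in>{k..<n}. (1 - a * q^(6*j+6)) * (a - q^(6*j+6))) * (B * (\<Prod>j\<in>{2*k..<2*n}. (1 + q ^ Suc j)^2))"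
    unfolding common_den_def split[OF k] split[of "2*k" "2*n", OF mult_le_mono2[OF k]] A_def B_def ..
  have T: "regular_term q a k = (\<Prod>j<k. (1 - a * q^(2*j+1)) * (a - q^(2*j+1))) / A * (qbin q (2*(2*k)) (2*k) / B) * q^(2*k^2)"
    unfolding regular_term_def qcen_def A_def B_def by (simp only: prod_dividef)
  have "P * E * Q * F * G * w = P / A * (Q / B) * w * G * (A * E * (B * F))" for P E Q F G w
    using AB by simp
  then show ?thesis unfolding term_num_def D T by blast
qed

context ring_hom_fun
begin

lemma hom_qbin: "h (qbin q n k) = qbin (h q) n k"
  by (induction q n k rule: qbin.induct) (simp_all add: hom_0 hom_1 hom_add hom_mult hom_power)

lemma hom_qgeom: "h (qgeom q n) = qgeom (h q) n"
  by (simp add: qgeom_def hom_sum hom_power)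

lemma hom_term_num: "h (term_num q a n k) = term_num (h q) (h a) n k"
  unfolding term_num_def by (simp only: hom_simps hom_qbin hom_qgeom)

lemma hom_common_den: "h (common_den q a n) = common_den (h q) (h a) n"
  unfolding common_den_def by (simp only: hom_simps)

lemma hom_diff_num: "h (diff_num q a n) = diff_num (h q) (h a) n"
  unfolding diff_num_def by (simp only: hom_simps hom_term_num hom_common_den hom_qgeom)

end

text \<open>For a = q^(-n) the parameter \<open>a * q\<close> is q^(1-n), as in
  \<open>terminating_sum\<close>; for a = q^n the symmetry \<open>cubic_coeff_swap\<close> leads to
  the same terms.\<close>

lemma diff_num_terminating:
  fixes q a :: "'a::field"
  assumes q0: "q \<noteq> 0" and q1: "\<And>j. j > 0 \<Longrightarrow> q^j \<noteq> 1" and n: "coprime n 6" and a: "a = q^n \<or> a = 1 / q^n"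
  shows "diff_num q a n = 0"
proof -
  note neg = not_root_of_unity_neg[OF q1]
  have n0: "odd n" "\<not> 3 dvd n" "n > 0" using n unfolding coprime_6_nat by (auto intro: Nat.gr0I)
  have a0: "a \<noteq> 0" using a q0 by auto
  \<comment> \<open>n is odd and 6 * j + 6 is even, so no denominator factor vanishes at these two
    points.\<close>
  have nn: "n \<noteq> 6*j+6" for j using n0(1) by auto
  have nz: "(1 - a * q^(6*j+6)) * (a - q^(6*j+6)) \<noteq> 0" for j
  proof -
    have 1: "q^(n+(6*j+6)) \<noteq> 1" by (rule q1) simp
    have 2: "q^n \<noteq> q^(6*j+6)" by (rule not_root_of_unity_neq[OF q0 q1 nn])
    from a show ?thesis
    proof
      assume "a = q^n"
      then show ?thesis using 1 2 by (simp add: power_add)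
    next
      assume a: "a = 1 / q^n"
      then have "1 - a * q^(6*j+6) = (q^n - q^(6*j+6)) / q^n" "a - q^(6*j+6) = (1 - q^(n+(6*j+6))) / q^n"
        using q0 by (simp_all add: diff_divide_distrib power_add)
      then show ?thesis using 1 2 q0 by simp
    qed
  qed
  have g: "cubic_coeff (q^2) (a * q) q k = cubic_coeff (q^2) (1 / q^(n-1)) q k" for k
    using a
  proof
    have qn: "q^n = q^(n-1) * q" using n0 by (simp add: power_eq_if)
    { assume "a = 1 / q^n"
      then have "a * q = 1 / q^(n-1)" using q0 unfolding qn by simp
      then show ?thesis by simp }
    assume "a = q^n"
    then have "q^2 / (a * q) = 1 / q^(n-1)" using q0 unfolding qn by (simp add: power2_eq_square)
    moreover have "cubic_coeff (q^2) (a * q) q k = cubic_coeff (q^2) (q^2 / (a * q)) q k"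
      using cubic_coeff_swap[of "a * q" "q^2" q k] a0 q0 by simp
    ultimately show ?thesis by simp
  qed
  have t: "regular_term q a k = cubic_coeff (q^2) (1 / q^(n-1)) q k" for k
    using trans[OF regular_term_eq[OF q1 neg a0, symmetric] summand_eq_cubic_coeff] g by simp
  have q11: "1 - q \<noteq> 0" using q1[of 1] by simp
  have "(1 - q) * (\<Sum>k<n. term_num q a n k) = (\<Sum>k<n. (1 - q^(8*k+1)) * cubic_coeff (q^2) (1 / q^(n-1)) q k) * common_den q a n"
    unfolding sum_distrib_left sum_distrib_right
  proof (rule sum.cong)
    fix k assume "k \<in> {..<n}"
    then have "(1 - q) * term_num q a n k = ((1 - q) * qgeom q (8*k+1)) * regular_term q a k * common_den q a n"
      using term_num_eq[OF neg nz, of k n] by (simp add: mult_ac)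
    then show "(1 - q) * term_num q a n k = (1 - q^(8*k+1)) * cubic_coeff (q^2) (1 / q^(n-1)) q k * common_den q a n"
      unfolding qgeom_mult t .
  qed simp
  also have "(\<Sum>k<n. (1 - q^(8*k+1)) * cubic_coeff (q^2) (1 / q^(n-1)) q k) = of_int (sgn3 n) * (1 - q^n) / q^((n-1) div 2)"
    by (rule terminating_sum[OF q0 q1 n]) (use n0 in auto)
  finally have "(1 - q) * ((\<Sum>k<n. term_num q a n k) * q^((n-1) div 2)) = of_int (sgn3 n) * (1 - q^n) * common_den q a n"
    using q0 by (simp add: field_simps)
  also have "\<dots> = (1 - q) * (of_int (sgn3 n) * qgeom q n * common_den q a n)"
    unfolding qgeom_mult[symmetric] by (simp only: mult_ac)
  finally show ?thesis using q11 unfolding diff_num_def by simp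
qed

text \<open>Both parts vanish separately: the sum by \<open>regular_term_root_sum\<close> for the
  order d of q, an odd divisor of n prime to 3, and [n] because q is a nontrivial n-th root of
  unity.\<close>

lemma diff_num_root_of_unity:
  fixes q a :: complex
  assumes n: "coprime n 6" and q: "q ^ n = 1" "q \<noteq> 1" and a: "norm a > 1"
  shows "diff_num q a n = 0"
proof -
  have n0: "odd n" "\<not> 3 dvd n" "n > 0" using n unfolding coprime_6_nat by (auto intro: Nat.gr0I)
  define d where "d = (LEAST d. d > 0 \<and> q^d = 1)"
  have d: "d > 0" "q^d = 1" using LeastI[of "\<lambda>d. d > 0 \<and> q^d = 1" n] n0 q by (auto simp: d_def)
  have least: "d \<le> j" if "j > 0" "q^j = 1" for j using Least_le[of "\<lambda>d. d > 0 \<and> q^d = 1" j] that by (simp add: d_def)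
  have ord: "q^j = 1 \<longleftrightarrow> d dvd j" for j
  proof
    assume "q^j = 1"
    have "q^j = (q^d)^(j div d) * q^(j mod d)" by (simp flip: power_mult power_add)
    then have "q^(j mod d) = 1" using d \<open>q^j = 1\<close> by simp
    then have "j mod d = 0" using least[of "j mod d"] d(1) mod_less_divisor[of d j] by fastforce
    then show "d dvd j" by (simp add: dvd_eq_mod_eq_0)
  qed (use d in \<open>auto simp: power_mult elim!: dvdE\<close>)
  have dn: "d dvd n" using ord q by blast
  have d1: "odd d" "\<not> 3 dvd d" using n0 dn dvd_trans by blast+
  have "d \<noteq> 1" using d(2) q(2) by auto
  then have d2: "d > 1" using d(1) by simp
  have nq: "norm q = 1" using d by (metis norm_power norm_one power_eq_1_iff less_imp_neq norm_ge_zero)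
  have neg: "q ^ Suc j \<noteq> -1" for j
  proof
    assume e: "q ^ Suc j = -1"
    have "(q ^ Suc j) ^ d = (q ^ d) ^ Suc j" by (simp only: power_mult[symmetric] mult.commute)
    then show False unfolding e using d d1 by simp
  qed
  have a0: "a \<noteq> 0" using a by auto
  \<comment> \<open>Powers of q have norm 1, whereas a has norm above 1.\<close>
  have aq: "a * q^i \<noteq> q^j" for i j
  proof
    assume "a * q^i = q^j"
    then have "norm a * norm q ^ i = norm q ^ j" by (metis norm_mult norm_power)
    then show False using a by (simp add: nq)
  qed
  have nz: "(1 - a * q^(6*j+6)) * (a - q^(6*j+6)) \<noteq> 0" for j
    using aq[of "6*j+6" 0] aq[of 0 "6*j+6"] by simp
  have "(1 - q) * (\<Sum>k<n. term_num q a n k) = (\<Sum>k<n. regular_term q a k * (1 - q^(8*k+1))) * common_den q a n"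
    unfolding sum_distrib_left sum_distrib_right
  proof (rule sum.cong)
    fix k assume "k \<in> {..<n}"
    then have "(1 - q) * term_num q a n k = regular_term q a k * ((1 - q) * qgeom q (8*k+1)) * common_den q a n"
      using term_num_eq[OF neg nz, of k n] by (simp add: mult_ac)
    then show "(1 - q) * term_num q a n k = regular_term q a k * (1 - q^(8*k+1)) * common_den q a n"
      unfolding qgeom_mult .
  qed simp
  also have "(\<Sum>k<n. regular_term q a k * (1 - q^(8*k+1))) = 0"
    by (rule regular_term_root_sum[OF d1(1) d2 d1(2) ord neg a0 aq dn])
  finally have "(\<Sum>k<n. term_num q a n k) = 0" using q by simp
  moreover have "qgeom q n = 0" using qgeom_mult[of q n] q by simp
  ultimately show ?thesis by (simp add: diff_num_def)
qed

section \<open>The modulus: divisibility and coprimality\<close>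

abbreviation (input) Qp :: "int poly poly" where "Qp \<equiv> [:[:0, 1:]:]"
abbreviation (input) Ap :: "int poly poly" where "Ap \<equiv> [:0, 1:]"

lemma ev2_diff_num: "ev2 z \<alpha> (diff_num Qp Ap n) = diff_num z \<alpha> n"
  by (simp add: ev2.hom_diff_num ev2_pCons ev2_0 ev.hom_0 ev.hom_1 ev_X)

lemma Qp_power: "Qp ^ m = [:[:0, 1:] ^ m:]"
  by (simp add: poly_const_pow)

lemma factor_1: "1 - Ap * Qp ^ m = [:1, - ([:0, 1:] ^ m):]"
  unfolding Qp_power by (simp add: one_pCons)

lemma factor_2: "Ap - Qp ^ m = [:- ([:0, 1:] ^ m), 1:]"
  unfolding Qp_power by simp

lemma X_power_eq_iff: "[:0, 1::int:] ^ i = [:0, 1:] ^ j \<longleftrightarrow> i = j"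
  unfolding monom_altdef[of 1, simplified, symmetric] by (simp add: monom_eq_iff')

lemma not_root_of_unity_norm:
  fixes z :: complex
  assumes "norm z > 1" "j > 0"
  shows "z ^ j \<noteq> 1"
  using one_less_power[OF assms(1), of j] assms(2) by (metis less_irrefl norm_one norm_power)

definition modulus :: "nat \<Rightarrow> int poly poly" where
  "modulus n = qgeom Qp n * (1 - Ap * Qp ^ n) * (Ap - Qp ^ n)"

lemma factors_coprime:
  assumes "n > 0"
  shows "coprime (qgeom Qp n) (1 - Ap * Qp ^ m)" "coprime (qgeom Qp n) (Ap - Qp ^ m)"
  using qgeom_X_neq_0[OF assms] unfolding qgeom_const factor_1 factor_2
  by (auto intro!: coprime_const_linear)

lemma linear_factors_coprime:
  shows "m + n > 0 \<Longrightarrow> coprime (1 - Ap * Qp ^ m) (Ap - Qp ^ n)"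
    and "m \<noteq> n \<Longrightarrow> coprime (1 - Ap * Qp ^ m) (1 - Ap * Qp ^ n)"
    and "m \<noteq> n \<Longrightarrow> coprime (Ap - Qp ^ m) (Ap - Qp ^ n)"
proof -
  assume "m + n > 0"
  then have "[:0, 1::int:] ^ (m + n) \<noteq> [:0, 1:] ^ 0" unfolding X_power_eq_iff by simp
  then show "coprime (1 - Ap * Qp ^ m) (Ap - Qp ^ n)"
    unfolding factor_1 factor_2 by (intro coprime_linear_linear) (simp_all add: power_add)
next
  assume "m \<noteq> n"
  then show "coprime (1 - Ap * Qp ^ m) (1 - Ap * Qp ^ n)"
    unfolding factor_1 by (intro coprime_linear_linear) (simp_all add: X_power_eq_iff)
next
  assume "m \<noteq> n"
  then show "coprime (Ap - Qp ^ m) (Ap - Qp ^ n)"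
    unfolding factor_2 by (intro coprime_linear_linear) (simp_all add: X_power_eq_iff)
qed

text \<open>[n], 1 - a q^n and a - q^n are pairwise coprime, so each is treated alone: the first at
  roots of unity, the others at a = q^(-n) and a = q^n.\<close>

lemma modulus_dvd_diff_num:
  assumes n: "n > 0" "coprime n 6"
  shows "modulus n dvd diff_num Qp Ap n"
proof -
  have 1: "qgeom Qp n dvd diff_num Qp Ap n"
  proof (rule qgeom_dvd_poly[OF n(1)])
    fix z \<alpha> :: complex
    assume "z ^ n = 1" "z \<noteq> 1" "norm \<alpha> > 1"
    then show "ev2 z \<alpha> (diff_num Qp Ap n) = 0"
      unfolding ev2_diff_num by (rule diff_num_root_of_unity[OF n(2)])
  qed
  have 2: "1 - Ap * Qp ^ n dvd diff_num Qp Ap n"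
    unfolding factor_1
  proof (rule linear_dvd_poly'[OF n(1)])
    fix z :: complex assume z: "norm z > 1"
    then have "z \<noteq> 0" by auto
    then show "ev2 z (1 / z ^ n) (diff_num Qp Ap n) = 0"
      unfolding ev2_diff_num using not_root_of_unity_norm[OF z] n(2) by (intro diff_num_terminating) auto
  qed
  have 3: "Ap - Qp ^ n dvd diff_num Qp Ap n"
    unfolding factor_2
  proof (rule linear_dvd_poly)
    fix z :: complex assume z: "norm z > 1"
    then have "z \<noteq> 0" by auto
    then show "ev2 z (z ^ n) (diff_num Qp Ap n) = 0"
      unfolding ev2_diff_num using not_root_of_unity_norm[OF z] n(2) by (intro diff_num_terminating) auto
  qed
  have "coprime (qgeom Qp n * (1 - Ap * Qp ^ n)) (Ap - Qp ^ n)"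
    using factors_coprime(2)[OF n(1)] linear_factors_coprime(1)[of n n] n(1) unfolding coprime_mult_left_iff by simp
  then show ?thesis
    unfolding modulus_def by (intro divides_mult 1 2 3 factors_coprime(1) n(1))
qed

text \<open>Linear factors of one kind share a divisor only if their exponents agree, but n is odd
  and 6 * j + 6 even. The other factors contain only q: they are coprime to the linear factors,
  which have content 1, and to [n] by the lemmas above.\<close>

lemma modulus_coprime_common_den:
  assumes n: "n > 0" "coprime n 6"
  shows "coprime (modulus n) (common_den Qp Ap n * Qp ^ m)"
proof -
  have odd: "odd n" using n unfolding coprime_6_nat by simp
  then have ne: "n \<noteq> 6*j+6" for j by auto
  have c: "qgeom Qp n = [:qgeom [:0,1:] n:]" by (rule qgeom_const)
  have g0: "qgeom [:0, 1::int:] n \<noteq> 0" by (rule qgeom_X_neq_0[OF n(1)])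
  have p: "1 + Qp ^ Suc j = [:1 + [:0,1:] ^ Suc j:]" for j unfolding Qp_power by (simp add: one_pCons)
  have X: "coprime (modulus n) Qp"
    unfolding modulus_def coprime_mult_left_iff
  proof (intro conjI)
    show "coprime (qgeom Qp n) Qp" unfolding c by (intro coprime_const_const g0 coprime_qgeom_X n)
    show "coprime (1 - Ap * Qp ^ n) Qp" unfolding factor_1
      by (subst coprime_commute) (rule coprime_const_linear, simp_all)
    show "coprime (Ap - Qp ^ n) Qp" unfolding factor_2
      by (subst coprime_commute) (rule coprime_const_linear, simp_all)
  qed
  have plus: "coprime (modulus n) (1 + Qp ^ Suc j)" for j
  proof -
    have "poly (1 + [:0, 1::int:] ^ Suc j) 0 = 1" by simp
    then have nz: "1 + [:0, 1::int:] ^ Suc j \<noteq> 0" by (metis poly_0 zero_neq_one)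
    show ?thesis
      unfolding modulus_def coprime_mult_left_iff
    proof (intro conjI)
      show "coprime (qgeom Qp n) (1 + Qp ^ Suc j)" unfolding c p by (intro coprime_const_const g0 coprime_qgeom_X_plus_1 odd)
      show "coprime (1 - Ap * Qp ^ n) (1 + Qp ^ Suc j)" unfolding factor_1 p
        by (subst coprime_commute) (rule coprime_const_linear[OF nz], simp)
      show "coprime (Ap - Qp ^ n) (1 + Qp ^ Suc j)" unfolding factor_2 p
        by (subst coprime_commute) (rule coprime_const_linear[OF nz], simp)
    qed
  qed
  have lin: "coprime (modulus n) ((1 - Ap * Qp ^ (6*j+6)) * (Ap - Qp ^ (6*j+6)))" for j
  proof -
    have s: "coprime (Ap - Qp ^ n) (1 - Ap * Qp ^ (6*j+6))"
      by (subst coprime_commute) (rule linear_factors_coprime(1), simp)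
    show ?thesis
      unfolding modulus_def coprime_mult_left_iff coprime_mult_right_iff
      by (intro conjI factors_coprime n(1) linear_factors_coprime s ne) simp
  qed
  show ?thesis
    unfolding common_den_def coprime_mult_right_iff
    by (intro conjI prod_coprime_right coprime_power_right_iff[THEN iffD2] disjI1 lin plus X)
qed

section \<open>Transfer to the fraction field\<close>

lemma power_int_half:
  fixes x :: "'a::field"
  shows "odd n \<Longrightarrow> x powi (- ((int n - 1) div 2)) = inverse (x ^ ((n - 1) div 2))"
proof -
  assume "odd n"
  then have "(int n - 1) div 2 = int ((n - 1) div 2)" by (auto elim!: oddE)
  then show ?thesis by (simp only: power_int_minus power_int_of_nat)
qed

theorem theorem5:
  fixes n :: nat and a q :: "int poly poly fract"
  assumes "n > 0" and "coprime n 6"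
    and "a = Fraction_Field.Fract [:0, 1:] 1"
    and "q = Fraction_Field.Fract [:[:0, 1:]:] 1"
  shows "fract_cong
     (\<Sum>k = 0..n - 1.
        (qpoch (a * q) (q ^ 2) k * qpoch (q / a) (q ^ 2) k * qpoch q (q ^ 2) (2 * k)) /
        (qpoch (q ^ 2) (q ^ 2) (2 * k) * qpoch (a * q ^ 6) (q ^ 6) k * qpoch (q ^ 6 / a) (q ^ 6) k) *
        qint q (8 * k + 1) * q ^ (2 * k ^ 2))
     (q powi (- ((int n - 1) div 2)) * qint q n * of_int (kronecker (-3) n))
     (qint q n * (1 - a * q ^ n) * (a - q ^ n))"
proof -
  interpret to_fract: ring_hom_fun "to_fract :: int poly poly \<Rightarrow> _" by (rule ring_hom_to_fract)
  have n3: "odd n" "\<not> 3 dvd n" using assms(2) unfolding coprime_6_nat by simp_all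
  have aq: "a = to_fract Ap" "q = to_fract Qp" by (simp_all add: assms(3,4) to_fract_def)
  have qp: "q ^ m = to_fract (Qp ^ m)" for m by (simp only: aq to_fract.hom_power)
  have q1: "q ^ j \<noteq> 1" if "j > 0" for j
  proof -
    have "Qp ^ j \<noteq> 1"
      using that X_power_eq_iff[of j 0] unfolding Qp_power by (simp add: one_pCons)
    then show ?thesis unfolding qp to_fract_1[symmetric] to_fract_eq_iff .
  qed
  have q0: "q \<noteq> 0" and a0: "a \<noteq> 0" by (simp_all add: aq)
  note neg = not_root_of_unity_neg[OF q1]
  have lin0: "1 - Ap * Qp ^ m \<noteq> 0" "Ap - Qp ^ m \<noteq> 0" for m
    unfolding factor_1 factor_2 by simp_all
  have nz: "(1 - a * q ^ (6*j+6)) * (a - q ^ (6*j+6)) \<noteq> 0" for j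
  proof -
    have "(1 - a * q ^ (6*j+6)) * (a - q ^ (6*j+6)) = to_fract ((1 - Ap * Qp ^ (6*j+6)) * (Ap - Qp ^ (6*j+6)))"
      unfolding qp aq(1) by (simp only: to_fract.hom_simps)
    then show ?thesis using lin0 by (simp only: to_fract_eq_0_iff mult_eq_0_iff simp_thms not_False_eq_True)
  qed
  have qint: "qint q m = qgeom q m" for m using qgeom_eq_qint[of q m] q1[of 1] by simp
  have td: "to_fract (common_den Qp Ap n) = common_den q a n" by (simp only: to_fract.hom_common_den aq)
  have td0: "common_den q a n \<noteq> 0"
  proof -
    have "1 + q ^ Suc j \<noteq> 0" for j using neg[of j] by (metis add.commute add_eq_0_iff)
    then show ?thesis unfolding common_den_def using nz by (simp del: power_Suc)
  qed
  define A where "A = (\<Sum>k = 0..n - 1.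
        (qpoch (a * q) (q ^ 2) k * qpoch (q / a) (q ^ 2) k * qpoch q (q ^ 2) (2 * k)) /
        (qpoch (q ^ 2) (q ^ 2) (2 * k) * qpoch (a * q ^ 6) (q ^ 6) k * qpoch (q ^ 6 / a) (q ^ 6) k) *
        qint q (8 * k + 1) * q ^ (2 * k ^ 2))"
  define B where "B = q powi (- ((int n - 1) div 2)) * qint q n * of_int (kronecker (-3) n)"
  define Q where "Q = q ^ ((n - 1) div 2)"
  have Q0: "Q \<noteq> 0" using q0 by (simp add: Q_def)
  have "A = (\<Sum>k<n. term_num q a n k / common_den q a n)"
    unfolding A_def
  proof (rule sum.cong)
    show "{0..n - 1} = {..<n}" using assms(1) by auto
    fix k assume "k \<in> {..<n}"
    then have T: "term_num q a n k / common_den q a n = regular_term q a k * qgeom q (8*k+1)"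
      using term_num_eq[OF neg nz, of k n] td0 by simp
    have "(qpoch (a * q) (q ^ 2) k * qpoch (q / a) (q ^ 2) k * qpoch q (q ^ 2) (2 * k)) /
        (qpoch (q ^ 2) (q ^ 2) (2 * k) * qpoch (a * q ^ 6) (q ^ 6) k * qpoch (q ^ 6 / a) (q ^ 6) k) * qint q (8 * k + 1) * q ^ (2 * k ^ 2)
      = ((qpoch (a * q) (q ^ 2) k * qpoch (q / a) (q ^ 2) k * qpoch q (q ^ 2) (2 * k)) /
        (qpoch (q ^ 2) (q ^ 2) (2 * k) * qpoch (a * q ^ 6) (q ^ 6) k * qpoch (q ^ 6 / a) (q ^ 6) k) * q ^ (2 * k ^ 2)) * qint q (8 * k + 1)"
      by (simp only: mult_ac)
    also have "\<dots> = term_num q a n k / common_den q a n"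
      by (simp only: T regular_term_eq[OF q1 neg a0] qint)
    finally show "(qpoch (a * q) (q ^ 2) k * qpoch (q / a) (q ^ 2) k * qpoch q (q ^ 2) (2 * k)) /
        (qpoch (q ^ 2) (q ^ 2) (2 * k) * qpoch (a * q ^ 6) (q ^ 6) k * qpoch (q ^ 6 / a) (q ^ 6) k) *
        qint q (8 * k + 1) * q ^ (2 * k ^ 2) = term_num q a n k / common_den q a n" .
  qed
  then have A: "A = (\<Sum>k<n. term_num q a n k) / common_den q a n" by (simp only: sum_divide_distrib)
  have B: "B = of_int (sgn3 n) * qgeom q n / Q"
    unfolding B_def power_int_half[OF n3(1)] kronecker_minus_3[OF assms(1) n3] qint Q_def by (simp add: field_simps)
  \<comment> \<open>Over the common denominator the numerator is \<open>diff_num\<close>. Being ring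
    expressions in a and q, both come from the same expressions in Z[q][a], which are the witnesses
    for \<open>fract_cong\<close>.\<close>
  have "A - B = diff_num q a n / (common_den q a n * Q)"
    unfolding A B diff_num_def Q_def[symmetric] by (rule diff_frac_eq[OF td0 Q0])
  also have "\<dots> = Fraction_Field.Fract (diff_num Qp Ap n) (common_den Qp Ap n * Qp ^ ((n - 1) div 2))"
    unfolding Fract_conv_to_fract by (simp only: to_fract.hom_diff_num to_fract.hom_mult to_fract.hom_common_den to_fract.hom_power Q_def aq)
  finally have AB: "A - B = Fraction_Field.Fract (diff_num Qp Ap n) (common_den Qp Ap n * Qp ^ ((n - 1) div 2))" .
  have "qint q n * (1 - a * q ^ n) * (a - q ^ n) = to_fract (modulus n)"
    unfolding modulus_def qint by (simp only: to_fract.hom_simps to_fract.hom_qgeom aq)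
  then have M: "qint q n * (1 - a * q ^ n) * (a - q ^ n) = Fraction_Field.Fract (modulus n) 1"
    by (simp add: to_fract_def)
  have "to_fract (common_den Qp Ap n * Qp ^ ((n - 1) div 2)) \<noteq> 0"
    unfolding to_fract_mult td qp[symmetric] using td0 q0 by simp
  then have "common_den Qp Ap n * Qp ^ ((n - 1) div 2) \<noteq> 0" unfolding to_fract_eq_0_iff .
  then show ?thesis
    unfolding fract_cong_def A_def[symmetric] B_def[symmetric]
    using AB M modulus_dvd_diff_num[OF assms(1,2)] modulus_coprime_common_den[OF assms(1,2)] by blast
qed

end
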